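(* Let $0<p<q<\infty$ and let $X$ be a nonnegative random variable with $\|X\|_q<\infty$. The following conditions are equivalent: (i) there exists a constant $C$ such that $\|m_n(X)\|_q\le C\|m_n(X)\|_p$ for all $n\ge 1$; (ii) there exist $\varepsilon<1$ and $\tau,\rho>0$ such that $P(X\le \tau t)\le \varepsilon P(X\le t)$ for all $t\le t_0=\rho\|X\|_p$; (iii) for each $\varepsilon>0$ and each $\rho>0$ there exists $\tau>0$ such that $P(X\le\tau t)\le\varepsilon P(X\le t)$ for all $t\le t_0=\rho\|X\|_p$; (iv) there exists $\sigma>0$ such that $(E(t\wedge\sigma X)^q)^{1/q}\le (E(t\wedge X)^p)^{1/p}$ for all $t\ge 0$.
   Context: For a random variable $W$ and $r>0$, $\|W\|_r=(E|W|^r)^{1/r}$. For a nonnegative random variable $X$ and $n\ge 1$, $m_n(X)=\min_{j\le n}X_j$, where $X_1,\dots,X_n$ are i.i.d. copies of $X$. $x\wedge y=\min\{x,y\}$.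
   Formalization: In (ii) and (iii) the condition is imposed for 0 < t ≤ t_0 instead of all t ≤ t_0; this is equivalent unless X = 0 almost surely, where t_0 = 0 and the original fails at t = 0 (it would require 1 ≤ ε) although (i) and (iv) hold. *)

theory Defs
  imports "HOL-Probability.Probability"
begin

(* (E|W|^r)^(1/r).  The Bochner integral is 0 when |W|^r is not integrable, so
   finiteness of the norm has to be expressed as integrability of |W|^r. *)
definition Lnorm :: "'a measure \<Rightarrow> real \<Rightarrow> ('a \<Rightarrow> real) \<Rightarrow> real" where
  "Lnorm M r W = (\<integral>\<omega>. \<bar>W \<omega>\<bar> powr r \<partial>M) powr (1 / r)"

(* The i.i.d. copies X_1, ..., X_n of X are realised as the coordinate copies
   \<omega> \<mapsto> X (\<omega> j) on the n-fold product space copy_space n M. By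
   Lnorm_min_copies_iid below, any other realisation gives the same norms. *)
definition copy_space :: "nat \<Rightarrow> 'a measure \<Rightarrow> (nat \<Rightarrow> 'a) measure" where
  "copy_space n M = (\<Pi>\<^sub>M j\<in>{1..n}. M)"

definition min_copies :: "nat \<Rightarrow> ('a \<Rightarrow> real) \<Rightarrow> (nat \<Rightarrow> 'a) \<Rightarrow> real" where
  "min_copies n X \<omega> = Min ((\<lambda>j. X (\<omega> j)) ` {1..n})"

lemma Lnorm_min_copies_iid:
  fixes M :: "'a measure" and N :: "'b measure"
    and X :: "'a \<Rightarrow> real" and Y :: "nat \<Rightarrow> 'b \<Rightarrow> real"
  assumes M: "prob_space M" and X: "X \<in> borel_measurable M"
    and N: "prob_space N"
    and Y: "\<And>j. j \<in> {1..n} \<Longrightarrow> Y j \<in> borel_measurable N"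
    and law: "\<And>j. j \<in> {1..n} \<Longrightarrow> distr N borel (Y j) = distr M borel X"
    and indep: "prob_space.indep_vars N (\<lambda>_. borel) Y {1..n}"
    and n: "n \<ge> 1"
  shows "Lnorm N r (\<lambda>\<omega>. Min ((\<lambda>j. Y j \<omega>) ` {1..n})) =
         Lnorm (copy_space n M) r (min_copies n X)"
proof -
  interpret M: prob_space M by fact
  interpret N: prob_space N by fact
  let ?I = "{1..n}"
  let ?P = "\<Pi>\<^sub>M j\<in>?I. (borel :: real measure)"
  define g :: "(nat \<Rightarrow> real) \<Rightarrow> real" where "g z = \<bar>Min ((\<lambda>j. z j) ` ?I)\<bar> powr r" for z
  have gm: "g \<in> borel_measurable ?P"
    unfolding g_def by measurable
  have Xm: "(\<lambda>\<omega>. \<lambda>j\<in>?I. X (\<omega> j)) \<in> copy_space n M \<rightarrow>\<^sub>M ?P"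
    unfolding copy_space_def using X by measurable
  have Ym: "(\<lambda>\<omega>. \<lambda>j\<in>?I. Y j \<omega>) \<in> N \<rightarrow>\<^sub>M ?P"
    using Y by (intro measurable_restrict) auto
  have dY: "distr N ?P (\<lambda>\<omega>. \<lambda>j\<in>?I. Y j \<omega>) = (\<Pi>\<^sub>M j\<in>?I. distr M borel X)"
  proof -
    have "distr N ?P (\<lambda>\<omega>. \<lambda>j\<in>?I. Y j \<omega>) = (\<Pi>\<^sub>M j\<in>?I. distr N borel (Y j))"
      using N.indep_vars_iff_distr_eq_PiM'[of ?I Y "\<lambda>_. borel"] n Y indep by auto
    also have "\<dots> = (\<Pi>\<^sub>M j\<in>?I. distr M borel X)"
      by (intro PiM_cong) (auto simp: law)
    finally show ?thesis .
  qed
  have dX: "distr (copy_space n M) ?P (\<lambda>\<omega>. \<lambda>j\<in>?I. X (\<omega> j)) = (\<Pi>\<^sub>M j\<in>?I. distr M borel X)"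
  proof -
    interpret D: prob_space "distr M borel X" by (rule M.prob_space_distr[OF X])
    let ?D = "distr M borel X"
    have XD: "X \<in> M \<rightarrow>\<^sub>M ?D" using X by simp
    have "distr (copy_space n M) ?P (compose ?I X) =
          distr (copy_space n M) (\<Pi>\<^sub>M j\<in>?I. ?D) (compose ?I X)"
      by (intro distr_cong sets_PiM_cong) auto
    also have "\<dots> = (\<Pi>\<^sub>M j\<in>?I. distr M ?D X)"
      unfolding copy_space_def
      by (rule distr_PiM_finite_prob_space') (auto simp: XD X M.prob_space_axioms D.prob_space_axioms)
    also have "distr M ?D X = ?D"
      by (rule distr_cong) auto
    finally have "distr (copy_space n M) ?P (compose ?I X) = (\<Pi>\<^sub>M j\<in>?I. ?D)" .
    moreover have "compose ?I X = (\<lambda>\<omega>. \<lambda>j\<in>?I. X (\<omega> j))"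
      by (rule ext) (simp add: compose_def)
    ultimately show ?thesis by simp
  qed
  have "(\<integral>\<omega>. g (\<lambda>j\<in>?I. Y j \<omega>) \<partial>N) = (\<integral>z. g z \<partial>(\<Pi>\<^sub>M j\<in>?I. distr M borel X))"
    using integral_distr[OF Ym gm] dY by simp
  moreover have "(\<integral>\<omega>. g (\<lambda>j\<in>?I. X (\<omega> j)) \<partial>copy_space n M) = (\<integral>z. g z \<partial>(\<Pi>\<^sub>M j\<in>?I. distr M borel X))"
    using integral_distr[OF Xm gm] dX by simp
  moreover have "g (\<lambda>j\<in>?I. f j) = \<bar>Min (f ` ?I)\<bar> powr r" for f
    unfolding g_def by (intro arg_cong[where f = "\<lambda>A. \<bar>Min A\<bar> powr r"] image_cong) auto
  ultimately show ?thesis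
    by (simp only: Lnorm_def min_copies_def)
qed

(* The small-ball conditions P(X \<le> \<tau>t) \<le> \<epsilon> P(X \<le> t) are imposed on 0 < t \<le> t_0.
   For X not almost surely 0, i.e. t_0 > 0, this is the same as imposing them on all
   real t \<le> t_0. For X = 0 almost surely, t_0 = 0 and the literal condition at t = 0
   would read 1 \<le> \<epsilon>, although the moment comparisons are trivially true. *)
lemma small_ball_nonpos_iff:
  fixes M :: "'a measure" and X :: "'a \<Rightarrow> real"
  assumes M: "prob_space M" and X: "X \<in> borel_measurable M"
    and nonneg: "AE \<omega> in M. 0 \<le> X \<omega>" and \<tau>: "\<tau> > 0" and c: "c > 0"
  shows "(\<forall>t\<le>c. \<P>(\<omega> in M. X \<omega> \<le> \<tau> * t) \<le> \<epsilon> * \<P>(\<omega> in M. X \<omega> \<le> t)) \<longleftrightarrow>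
         (\<forall>t. 0 < t \<and> t \<le> c \<longrightarrow> \<P>(\<omega> in M. X \<omega> \<le> \<tau> * t) \<le> \<epsilon> * \<P>(\<omega> in M. X \<omega> \<le> t))"
    (is "?L \<longleftrightarrow> ?R")
proof
  assume ?L then show ?R by blast
next
  assume R: ?R
  interpret prob_space M by fact
  interpret D: real_distribution "distr M borel X" by (rule real_distribution_distr[OF X])
  let ?F = "cdf (distr M borel X)"
  have F: "\<P>(\<omega> in M. X \<omega> \<le> t) = ?F t" for t
    unfolding cdf_def2 using X
    by (subst measure_distr) (auto intro!: arg_cong[where f = "measure M"])
  have F_neg: "?F t = 0" if "t < 0" for t
  proof -
    have "AE \<omega> in M. \<not> X \<omega> \<le> t" using nonneg by (rule AE_mp) (use that in auto)
    then show ?thesis unfolding F[symmetric] using X by (subst prob_eq_0) auto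
  qed
  have lim: "(?F \<longlongrightarrow> ?F 0) (at_right 0)"
    using D.cdf_is_right_cont[of 0] by (simp add: continuous_within)
  have "filterlim (\<lambda>t. \<tau> * t) (at_right 0) (at_right 0)"
    unfolding filterlim_at using \<tau>
    by (auto intro!: tendsto_eq_intros simp: eventually_at_filter)
  from filterlim_compose[OF lim this]
  have lim': "((\<lambda>t. ?F (\<tau> * t)) \<longlongrightarrow> ?F 0) (at_right 0)" .
  have "?F 0 \<le> \<epsilon> * ?F 0"
  proof (rule tendsto_le[OF _ tendsto_mult_left[OF lim] lim'])
    show "\<forall>\<^sub>F t in at_right 0. ?F (\<tau> * t) \<le> \<epsilon> * ?F t"
      unfolding eventually_at_right_field using R c by (auto simp: F intro!: exI[of _ c])
  qed auto
  then show ?L using R \<tau> F_neg unfolding F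
    by (metis linorder_neqE_linordered_idom mult_pos_neg mult_zero_right order_refl)
qed

end

theory Submission
  imports Defs
begin

text \<open>
  Write \<open>F t = P(X \<le> t)\<close> and \<open>G t = P(X > t) = 1 - F t\<close>. The minimum of \<open>n\<close> independent copies has
  tail \<open>G\<^sup>n\<close> (\<open>min_copies_rv\<close>), so all four conditions are statements about \<open>G\<close> alone. If \<open>X = 0\<close>
  almost surely, all of them hold trivially; otherwise \<open>\<parallel>X\<parallel>\<^sub>p > 0\<close> and it is enough to find the decay
  \<open>F(\<tau> t) \<le> \<epsilon> F(t)\<close> on some interval \<open>(0, c]\<close> with \<open>c > 0\<close>.

  (ii) and (iii) are equivalent because the decay can be iterated: \<open>k\<close> steps replace \<open>\<epsilon>, \<tau>\<close> by
  \<open>\<epsilon>\<^sup>k, \<tau>\<^sup>k\<close>, and a larger range of \<open>t\<close> is paid for by a further decrease of \<open>\<tau>\<close>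
  (\<open>small_ball_decay_improve\<close>).

  (iii) and (iv) are linked by two estimates of a truncated moment,
  \<open>1 - F(t/\<sigma>) \<le> E(1 \<and> \<sigma>X/t)\<^sup>r \<le> 1 - (1 - \<delta>\<^sup>r) F(\<delta>t/\<sigma>)\<close>. For small \<open>t\<close>, condition (iv) thus amounts to
  \<open>(1 - b)\<^sup>p \<le> (1 - a)\<^sup>q\<close>, where \<open>a\<close> and \<open>b\<close> are, up to constant factors, values of \<open>F\<close> at two
  proportional points. Strong decay gives the comparison (\<open>trunc_comparison_small\<close>), and since \<open>q / p > 1\<close> the
  comparison gives back decay with some \<open>\<epsilon> < 1\<close> (\<open>trunc_comparison_imp_decay\<close>). For large \<open>t\<close>,
  (iv) only needs \<open>\<sigma>\<close> to be small.

  (iii) implies (i) by a doubling argument. Decay with \<open>\<epsilon> = 1/2\<close> says \<open>G(t) \<le> 1 - 2 F(\<tau>t) \<le> G(\<tau>t)\<^sup>2\<close>,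
  and this passes to the \<open>n\<close>-th powers with the same \<open>\<tau>\<close>. The Markov inequality for the \<open>p\<close>-th moment
  of the minimum makes \<open>G\<^sup>n\<close> small beyond a multiple of its \<open>p\<close>-norm, and from there on squaring beats
  the factor \<open>\<tau>\<^sup>-\<^sup>q\<close> lost by rescaling, so the integral representing the \<open>q\<close>-th moment absorbs all but a
  multiple of the right power of the \<open>p\<close>-norm (\<open>nn_integral_le_of_squaring\<close>).

  (i) implies (ii) by comparing \<open>F\<close> at two multiples of \<open>a\<^sub>n = \<parallel>m\<^sub>n(X)\<parallel>\<^sub>p\<close>. By the Paley-Zygmund
  inequality \<open>G(\<theta> a\<^sub>n)\<^sup>n\<close> is bounded below, so \<open>F(\<theta> a\<^sub>n) \<le> L/n\<close>; by the Markov inequality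
  \<open>G(K a\<^sub>n)\<^sup>n \<le> K\<^sup>-\<^sup>p\<close>, so \<open>F(K a\<^sub>n)\<close> exceeds \<open>1/2\<close> or a much larger multiple of \<open>1/n\<close> when \<open>K\<close> is large.
  A small \<open>t\<close> either lies between \<open>K a\<^sub>n\<close> and \<open>K a\<^sub>n\<^sub>-\<^sub>1\<close> for some \<open>n\<close>, or below all \<open>K a\<^sub>n\<close>, and then
  \<open>F(\<theta> t/K) = 0\<close> (\<open>min_copies_comparison_imp_decay\<close>).
\<close>

section \<open>Elementary inequalities\<close>

lemma less_powr_iff:
  fixes u x r :: real
  assumes "0 < u" "0 < r" "0 \<le> x"
  shows "u < x powr r \<longleftrightarrow> u powr (1 / r) < x"
proof -
  have "u powr (1 / r) < x \<longleftrightarrow> (u powr (1 / r)) powr r < x powr r"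
    using assms by (smt (verit) powr_less_mono2 powr_mono2 powr_ge_zero)
  then show ?thesis using assms by (simp add: powr_powr)
qed

text \<open>
  A substitute for the Bernoulli inequality that covers exponents on both sides of 1: both sides
  are compared with \<open>exp (- s * x)\<close>.
\<close>
lemma one_minus_powr_le:
  fixes x s :: real
  assumes "0 \<le> x" "x \<le> 1" "0 < s"
  shows "(1 - x) powr s \<le> 1 / (1 + s * x)"
proof -
  have "(1 - x) powr s \<le> exp (- x) powr s"
    using assms exp_ge_add_one_self[of "- x"] by (intro powr_mono2) auto
  also have "\<dots> = exp (- (s * x))" by (simp add: powr_def)
  also have "\<dots> = 1 / exp (s * x)" by (simp add: exp_minus inverse_eq_divide)
  also have "\<dots> \<le> 1 / (1 + s * x)"
    using assms exp_ge_add_one_self[of "s * x"] by (intro divide_left_mono) (auto intro!: mult_pos_pos add_pos_nonneg)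
  finally show ?thesis .
qed

text \<open>
  The self-improvement step behind the bound on the minima. Rescaling the variable by \<open>\<kappa>\<close> and using
  the squaring hypothesis bounds the integral \<open>I\<close> of \<open>H\<close> over \<open>(0, T)\<close> by \<open>1 / \<kappa>\<close> times the integral
  of \<open>H\<^sup>2\<close>. On \<open>(0, B]\<close> the square is at most 1, and beyond \<open>B\<close> it is at most \<open>\<kappa> / 2 * H\<close>; hence
  \<open>I \<le> B / \<kappa> + I / 2\<close>, and since \<open>I \<le> T\<close> is finite the last term can be absorbed.
\<close>
lemma nn_integral_le_of_squaring:
  fixes H :: "real \<Rightarrow> real"
  assumes [measurable]: "H \<in> borel_measurable borel"
    and H: "\<And>u. 0 \<le> H u" "\<And>u. H u \<le> 1"
    and \<kappa>: "0 < \<kappa>" "\<kappa> \<le> 1" and T: "0 \<le> T" and B: "0 \<le> B"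
    and sq: "\<And>v. 0 < v \<Longrightarrow> v < \<kappa> * T \<Longrightarrow> H (v / \<kappa>) \<le> (H v)\<^sup>2"
    and small: "\<And>v. B < v \<Longrightarrow> H v \<le> \<kappa> / 2"
  shows "(\<integral>\<^sup>+u. ennreal (H u) * indicator {0<..<T} u \<partial>lborel) \<le> ennreal (2 * B / \<kappa>)"
proof -
  define f :: "real \<Rightarrow> ennreal" where "f u = ennreal (H u) * indicator {0<..<T} u" for u
  have [measurable]: "f \<in> borel_measurable borel" unfolding f_def by measurable
  have "integral\<^sup>N lborel f \<le> (\<integral>\<^sup>+u. indicator {0<..<T} u \<partial>lborel)"
    unfolding f_def using H by (intro nn_integral_mono) (auto simp: indicator_def)
  also have "\<dots> < \<infinity>" using T by simp
  finally obtain i where i: "integral\<^sup>N lborel f = ennreal i" "0 \<le> i"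
    by (cases "integral\<^sup>N lborel f") auto
  have pt: "f (v / \<kappa>) \<le> indicator {0<..B} v + ennreal (\<kappa> / 2) * f v" for v
  proof (cases "0 < v \<and> v < \<kappa> * T")
    case True
    then have vT: "v / \<kappa> < T" "0 < v / \<kappa>" using \<kappa> by (auto simp: field_simps)
    have "\<kappa> * T \<le> T" using \<kappa> T by (simp add: mult_left_le_one_le)
    with True have v: "0 < v" "v < T" by auto
    show ?thesis
    proof (cases "v \<le> B")
      case True
      then show ?thesis using v vT H(2)[of "v / \<kappa>"] by (auto simp: f_def intro!: add_increasing2)
    next
      case False
      have "H (v / \<kappa>) \<le> (H v)\<^sup>2" using sq True \<open>0 < v \<and> v < \<kappa> * T\<close> by blast
      also have "\<dots> \<le> \<kappa> / 2 * H v"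
        unfolding power2_eq_square using small False H by (intro mult_right_mono) auto
      finally have "ennreal (H (v / \<kappa>)) \<le> ennreal (\<kappa> / 2) * ennreal (H v)"
        using \<kappa> H by (subst ennreal_mult[symmetric]) (auto intro: ennreal_leI)
      then show ?thesis using v vT False by (simp add: f_def)
    qed
  next
    case False
    then show ?thesis using \<kappa> by (auto simp: f_def indicator_def field_simps)
  qed
  have "integral\<^sup>N lborel f = ennreal (1 / \<kappa>) * (\<integral>\<^sup>+v. f (v / \<kappa>) \<partial>lborel)"
    using nn_integral_real_affine[of f "1 / \<kappa>" 0] \<kappa> by simp
  also have "\<dots> \<le> ennreal (1 / \<kappa>) * (\<integral>\<^sup>+v. indicator {0<..B} v + ennreal (\<kappa> / 2) * f v \<partial>lborel)"
    by (intro mult_left_mono nn_integral_mono pt) simp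
  also have "(\<integral>\<^sup>+v. indicator {0<..B} v + ennreal (\<kappa> / 2) * f v \<partial>lborel)
      = ennreal B + ennreal (\<kappa> / 2) * ennreal i"
    using B by (simp add: nn_integral_add nn_integral_cmult i)
  also have "ennreal (1 / \<kappa>) * \<dots> = ennreal (1 / \<kappa> * (B + \<kappa> / 2 * i))"
    using \<kappa> B i by (simp add: ennreal_mult ennreal_plus flip: ennreal_mult'' ennreal_plus)
  finally have "i \<le> 1 / \<kappa> * (B + \<kappa> / 2 * i)"
    using \<kappa> B i by (subst (asm) i) (auto simp: ennreal_le_iff)
  then have "i \<le> 2 * B / \<kappa>" using \<kappa> by (simp add: field_simps)
  then show ?thesis using i by (simp add: f_def[abs_def] ennreal_leI)
qed

section \<open>Tails, moments and minima of a nonnegative random variable\<close>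

text \<open>
  The minimum of independent copies is again such a variable, on the product space, so everything
  proved in this locale applies to \<open>X\<close> and to its minima alike.
\<close>
locale nonneg_rv = prob_space M for M :: "'a measure" +
  fixes X :: "'a \<Rightarrow> real"
  assumes measurable_X [measurable]: "X \<in> borel_measurable M"
    and AE_nonneg: "AE \<omega> in M. 0 \<le> X \<omega>"
begin

definition small_ball :: "real \<Rightarrow> real" where
  "small_ball t = \<P>(\<omega> in M. X \<omega> \<le> t)"

definition tail :: "real \<Rightarrow> real" where
  "tail t = \<P>(\<omega> in M. t < X \<omega>)"

abbreviation moment :: "real \<Rightarrow> real" where
  "moment r \<equiv> (\<integral>\<omega>. \<bar>X \<omega>\<bar> powr r \<partial>M)"

lemma tail_eq: "tail t = 1 - small_ball t"
proof -
  have "small_ball t = 1 - tail t"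
    unfolding tail_def small_ball_def
    by (subst prob_compl[symmetric]) (auto intro!: arg_cong[where f = prob])
  then show ?thesis by simp
qed

lemma small_ball_nonneg [simp]: "0 \<le> small_ball t"
  and small_ball_le_1 [simp]: "small_ball t \<le> 1"
  by (simp_all add: small_ball_def)

lemma tail_nonneg [simp]: "0 \<le> tail t"
  and tail_le_1 [simp]: "tail t \<le> 1"
  by (simp_all add: tail_def)

lemma small_ball_mono: "s \<le> t \<Longrightarrow> small_ball s \<le> small_ball t"
  unfolding small_ball_def by (intro finite_measure_mono) auto

lemma tail_antimono: "s \<le> t \<Longrightarrow> tail t \<le> tail s"
  using small_ball_mono by (simp add: tail_eq)

lemma tail_measurable [measurable]: "tail \<in> borel_measurable borel"
proof -
  have "mono (\<lambda>t. - tail t)" by (auto simp: mono_def tail_antimono)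
  from borel_measurable_mono[OF this] show ?thesis
    by simp
qed

lemma emeasure_powr_gt:
  assumes "0 < u" "0 < r"
  shows "emeasure M {\<omega> \<in> space M. u < \<bar>X \<omega>\<bar> powr r} = ennreal (tail (u powr (1 / r)))"
proof -
  have "emeasure M {\<omega> \<in> space M. u < \<bar>X \<omega>\<bar> powr r}
      = emeasure M {\<omega> \<in> space M. u powr (1 / r) < X \<omega>}"
  proof (rule emeasure_eq_AE)
    show "AE \<omega> in M. \<omega> \<in> {\<omega> \<in> space M. u < \<bar>X \<omega>\<bar> powr r} \<longleftrightarrow>
        \<omega> \<in> {\<omega> \<in> space M. u powr (1 / r) < X \<omega>}"
      using AE_nonneg by eventually_elim (use assms less_powr_iff in auto)
  qed auto
  then show ?thesis by (simp add: tail_def emeasure_eq_measure)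
qed

text \<open>
  Fubini for the region under the graph of \<open>\<bar>X\<bar> powr r\<close>. Parametrising by the level of \<open>\<bar>X\<bar> powr r\<close>
  rather than of \<open>X\<close> keeps the reference measure Lebesgue, so that a dilation of \<open>X\<close> later becomes
  a linear change of variable.
\<close>
lemma moment_layer_cake:
  assumes r: "0 < r"
  shows "(\<integral>\<^sup>+\<omega>. ennreal (\<bar>X \<omega>\<bar> powr r) \<partial>M)
       = (\<integral>\<^sup>+u. ennreal (tail (u powr (1 / r))) * indicator {0<..} u \<partial>lborel)"
proof -
  interpret P: pair_sigma_finite M lborel ..
  let ?f = "\<lambda>\<omega> u. indicator {u. 0 < u \<and> u < \<bar>X \<omega>\<bar> powr r} u :: ennreal"
  have "(\<integral>\<^sup>+\<omega>. ennreal (\<bar>X \<omega>\<bar> powr r) \<partial>M) = (\<integral>\<^sup>+\<omega>. (\<integral>\<^sup>+u. ?f \<omega> u \<partial>lborel) \<partial>M)"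
  proof (rule nn_integral_cong)
    fix \<omega>
    have "{u. 0 < u \<and> u < \<bar>X \<omega>\<bar> powr r} = {0<..<\<bar>X \<omega>\<bar> powr r}" by auto
    then show "ennreal (\<bar>X \<omega>\<bar> powr r) = (\<integral>\<^sup>+u. ?f \<omega> u \<partial>lborel)"
      by simp
  qed
  also have "\<dots> = (\<integral>\<^sup>+u. (\<integral>\<^sup>+\<omega>. ?f \<omega> u \<partial>M) \<partial>lborel)"
    by (rule P.Fubini'[symmetric]) (measurable)
  also have "\<dots> = (\<integral>\<^sup>+u. ennreal (tail (u powr (1 / r))) * indicator {0<..} u \<partial>lborel)"
  proof (rule nn_integral_cong)
    fix u :: real
    have "(\<integral>\<^sup>+\<omega>. ?f \<omega> u \<partial>M)
        = (\<integral>\<^sup>+\<omega>. indicator {\<omega> \<in> space M. u < \<bar>X \<omega>\<bar> powr r} \<omega> * indicator {0<..} u \<partial>M)"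
      by (intro nn_integral_cong) (auto simp: indicator_def)
    also have "\<dots> = emeasure M {\<omega> \<in> space M. u < \<bar>X \<omega>\<bar> powr r} * indicator {0<..} u"
      by (subst nn_integral_multc) auto
    also have "\<dots> = ennreal (tail (u powr (1 / r))) * indicator {0<..} u"
      using emeasure_powr_gt[OF _ r, of u] by (auto simp: indicator_def)
    finally show "(\<integral>\<^sup>+\<omega>. ?f \<omega> u \<partial>M) = ennreal (tail (u powr (1 / r))) * indicator {0<..} u" .
  qed
  finally show ?thesis .
qed

lemma moment_eq_0:
  assumes "0 < r" and "\<And>s. 0 < s \<Longrightarrow> tail s = 0"
  shows "moment r = 0"
proof -
  have "(\<integral>\<^sup>+\<omega>. ennreal (\<bar>X \<omega>\<bar> powr r) \<partial>M) = (\<integral>\<^sup>+(u::real). 0 \<partial>lborel)"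
    unfolding moment_layer_cake[OF assms(1)]
    by (intro nn_integral_cong) (auto simp: indicator_def assms(2))
  then show ?thesis by (simp add: integral_eq_nn_integral)
qed

lemma integrable_powr_le:
  assumes "0 < r" "r \<le> q" "integrable M (\<lambda>\<omega>. \<bar>X \<omega>\<bar> powr q)"
  shows "integrable M (\<lambda>\<omega>. \<bar>X \<omega>\<bar> powr r)"
proof (rule Bochner_Integration.integrable_bound)
  show "integrable M (\<lambda>\<omega>. 1 + \<bar>X \<omega>\<bar> powr q)" using assms by simp
  show "AE \<omega> in M. norm (\<bar>X \<omega>\<bar> powr r) \<le> norm (1 + \<bar>X \<omega>\<bar> powr q)"
  proof (rule AE_I2)
    fix \<omega>
    have "\<bar>X \<omega>\<bar> powr r \<le> 1 + \<bar>X \<omega>\<bar> powr q"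
    proof (cases "\<bar>X \<omega>\<bar> \<le> 1")
      case True
      then show ?thesis using powr_le1[of r "\<bar>X \<omega>\<bar>"] assms powr_ge_zero[of "\<bar>X \<omega>\<bar>" q] by (auto simp del: powr_ge_zero)
    next
      case False
      then have "\<bar>X \<omega>\<bar> powr r \<le> \<bar>X \<omega>\<bar> powr q" using assms by (intro powr_mono) auto
      then show ?thesis by linarith
    qed
    then show "norm (\<bar>X \<omega>\<bar> powr r) \<le> norm (1 + \<bar>X \<omega>\<bar> powr q)" by simp
  qed
qed simp

lemma tail_Markov:
  assumes "0 < r" "0 < s" "integrable M (\<lambda>\<omega>. \<bar>X \<omega>\<bar> powr r)"
  shows "s powr r * tail s \<le> moment r"
proof -
  have "s powr r * tail s = (\<integral>\<omega>. s powr r * indicator {\<omega> \<in> space M. s < X \<omega>} \<omega> \<partial>M)"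
    by (simp add: tail_def)
  also have "\<dots> \<le> moment r"
  proof (rule integral_mono)
    show "s powr r * indicator {\<omega> \<in> space M. s < X \<omega>} \<omega> \<le> \<bar>X \<omega>\<bar> powr r" for \<omega>
      using assms by (auto simp: indicator_def intro!: powr_mono2)
    show "integrable M (\<lambda>\<omega>. s powr r * indicator {\<omega> \<in> space M. s < X \<omega>} \<omega>)"
      by (intro integrable_mult_right integrable_real_indicator) (auto simp: emeasure_eq_measure)
  qed (use assms in auto)
  finally show ?thesis .
qed

lemma Lnorm_powr: "0 < r \<Longrightarrow> Lnorm M r X powr r = moment r"
  by (simp add: Lnorm_def powr_powr)

lemma Lnorm_nonneg [simp]: "0 \<le> Lnorm M r X"
  by (simp add: Lnorm_def)

text \<open>
  Provides a point at a fixed multiple of the norm that \<open>X\<close> exceeds with positive probability: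
  otherwise \<open>X\<close> would be almost surely at most half of its own norm.
\<close>
lemma tail_half_Lnorm_pos:
  assumes p: "0 < p" and int: "integrable M (\<lambda>\<omega>. \<bar>X \<omega>\<bar> powr p)" and pos: "0 < Lnorm M p X"
  shows "0 < tail (Lnorm M p X / 2)"
proof (rule ccontr)
  let ?c = "Lnorm M p X / 2"
  assume "\<not> 0 < tail ?c"
  then have "tail ?c = 0" using tail_nonneg[of ?c] by linarith
  then have "AE \<omega> in M. \<not> ?c < X \<omega>"
    unfolding tail_def by (subst (asm) prob_eq_0) auto
  then have "AE \<omega> in M. \<bar>X \<omega>\<bar> powr p \<le> ?c powr p"
    using AE_nonneg by eventually_elim (use p in \<open>auto intro!: powr_mono2\<close>)
  then have "moment p \<le> (\<integral>\<omega>. ?c powr p \<partial>M)"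
    by (intro integral_mono_AE int) auto
  then have "Lnorm M p X powr p \<le> ?c powr p"
    using p by (simp add: Lnorm_powr prob_space)
  moreover have "?c powr p < Lnorm M p X powr p"
    using p pos by (intro powr_less_mono2) auto
  ultimately show False by simp
qed

lemma Lnorm_pos:
  assumes "0 < s" "0 < tail s" "0 < r" "integrable M (\<lambda>\<omega>. \<bar>X \<omega>\<bar> powr r)"
  shows "0 < Lnorm M r X"
proof -
  have "0 < s powr r * tail s" using assms by simp
  also have "\<dots> \<le> moment r" by (intro tail_Markov assms)
  finally show ?thesis by (simp add: Lnorm_def)
qed

text \<open>
  The minimum exceeds \<open>t\<close> iff all coordinates do, which is a product set; the same computation for the
  half-line \<open>[0, \<infinity>)\<close> shows that the minimum is almost surely nonnegative.
\<close>
lemma min_copies_rv: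
  assumes n: "1 \<le> n"
  shows "nonneg_rv (copy_space n M) (min_copies n X)"
    and "nonneg_rv.tail (copy_space n M) (min_copies n X) t = tail t ^ n"
proof -
  interpret P: product_prob_space "\<lambda>_. M" "{1..n}" by standard
  have meas: "min_copies n X \<in> borel_measurable (copy_space n M)"
    unfolding copy_space_def min_copies_def by measurable
  have box: "\<P>(\<omega> in copy_space n M. \<forall>j\<in>{1..n}. X (\<omega> j) \<in> A) = \<P>(\<omega> in M. X \<omega> \<in> A) ^ n"
    if [measurable]: "A \<in> sets borel" for A
  proof -
    have "{\<omega> \<in> space (copy_space n M). \<forall>j\<in>{1..n}. X (\<omega> j) \<in> A}
        = {\<omega> \<in> space (Pi\<^sub>M {1..n} (\<lambda>_. M)). \<forall>j\<in>{1..n}. \<omega> j \<in> {x \<in> space M. X x \<in> A}}"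
      unfolding copy_space_def by (auto simp: space_PiM)
    then have "emeasure (copy_space n M) {\<omega> \<in> space (copy_space n M). \<forall>j\<in>{1..n}. X (\<omega> j) \<in> A}
        = ennreal (\<P>(\<omega> in M. X \<omega> \<in> A) ^ n)"
      using P.emeasure_PiM_Collect[of "{1..n}" "\<lambda>_. {x \<in> space M. X x \<in> A}"]
      by (simp add: copy_space_def emeasure_eq_measure ennreal_power)
    then show ?thesis
      unfolding copy_space_def P.P.emeasure_eq_measure by simp
  qed
  have gr: "t < min_copies n X \<omega> \<longleftrightarrow> (\<forall>j\<in>{1..n}. X (\<omega> j) \<in> {t<..})" for t \<omega>
    unfolding min_copies_def using n by (subst Min_gr_iff) auto
  have ge: "0 \<le> min_copies n X \<omega> \<longleftrightarrow> (\<forall>j\<in>{1..n}. X (\<omega> j) \<in> {0..})" for \<omega>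
    unfolding min_copies_def using n by (subst Min_ge_iff) auto
  interpret Q: prob_space "copy_space n M"
    unfolding copy_space_def by (rule P.prob_space_axioms)
  have "\<P>(\<omega> in copy_space n M. 0 \<le> min_copies n X \<omega>) = 1"
    unfolding ge box[OF atLeast_borel] using AE_nonneg
    by (subst prob_Collect_eq_1[THEN iffD2]) auto
  then have "AE \<omega> in copy_space n M. 0 \<le> min_copies n X \<omega>"
    using meas by (subst (asm) Q.prob_Collect_eq_1) auto
  with meas show rv: "nonneg_rv (copy_space n M) (min_copies n X)"
    by unfold_locales
  show "nonneg_rv.tail (copy_space n M) (min_copies n X) t = tail t ^ n"
    unfolding nonneg_rv.tail_def[OF rv] gr box[OF greaterThan_borel] tail_def by simp
qed

lemma integrable_min_copies_powr:
  assumes n: "1 \<le> n" and r: "0 < r" and int: "integrable M (\<lambda>\<omega>. \<bar>X \<omega>\<bar> powr r)"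
  shows "integrable (copy_space n M) (\<lambda>\<omega>. \<bar>min_copies n X \<omega>\<bar> powr r)"
proof -
  interpret Y: nonneg_rv "copy_space n M" "min_copies n X" by (rule min_copies_rv[OF n])
  have "(\<integral>\<^sup>+\<omega>. ennreal (\<bar>min_copies n X \<omega>\<bar> powr r) \<partial>copy_space n M)
      \<le> (\<integral>\<^sup>+\<omega>. ennreal (\<bar>X \<omega>\<bar> powr r) \<partial>M)"
    unfolding moment_layer_cake[OF r] Y.moment_layer_cake[OF r] min_copies_rv(2)[OF n]
    using n by (intro nn_integral_mono mult_right_mono ennreal_leI power_le_one_iff)
      (auto intro!: power_decreasing[of 1, simplified])
  also have "\<dots> < \<infinity>" using int by (simp add: integrable_iff_bounded)
  finally show ?thesis by (simp add: integrable_iff_bounded)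
qed


section \<open>Moments of truncated variables\<close>

lemma integrable_trunc_powr:
  assumes "0 \<le> t" "0 < \<sigma>" "0 < r"
  shows "integrable M (\<lambda>\<omega>. min t (\<sigma> * X \<omega>) powr r)"
proof (rule Bochner_Integration.integrable_bound)
  show "integrable M (\<lambda>_. t powr r)" by simp
  show "AE \<omega> in M. norm (min t (\<sigma> * X \<omega>) powr r) \<le> norm (t powr r)"
    using AE_nonneg by eventually_elim (use assms in \<open>auto intro!: powr_mono2\<close>)
qed simp

text \<open>
  The integrand equals \<open>t powr r\<close> wherever \<open>X > t / \<sigma>\<close>.
\<close>
lemma trunc_moment_ge:
  assumes t: "0 < t" and \<sigma>: "0 < \<sigma>" and r: "0 < r"
  shows "t powr r * (1 - small_ball (t / \<sigma>)) \<le> (\<integral>\<omega>. min t (\<sigma> * X \<omega>) powr r \<partial>M)"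
proof -
  have "t powr r * (1 - small_ball (t / \<sigma>))
      = (\<integral>\<omega>. t powr r * indicator {\<omega> \<in> space M. t / \<sigma> < X \<omega>} \<omega> \<partial>M)"
    by (simp add: tail_def flip: tail_eq)
  also have "\<dots> \<le> (\<integral>\<omega>. min t (\<sigma> * X \<omega>) powr r \<partial>M)"
  proof (rule integral_mono)
    show "integrable M (\<lambda>\<omega>. t powr r * indicator {\<omega> \<in> space M. t / \<sigma> < X \<omega>} \<omega>)"
      by (intro integrable_mult_right integrable_real_indicator) (auto simp: emeasure_eq_measure)
    show "t powr r * indicator {\<omega> \<in> space M. t / \<sigma> < X \<omega>} \<omega> \<le> min t (\<sigma> * X \<omega>) powr r" for \<omega>
      using \<sigma> by (auto simp: indicator_def min_def field_simps)
  qed (use assms in \<open>auto intro: integrable_trunc_powr\<close>)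
  finally show ?thesis .
qed

text \<open>
  The integrand never exceeds \<open>t powr r\<close>, and where \<open>X \<le> \<delta> * t / \<sigma>\<close> it is at most \<open>(\<delta> * t) powr r\<close>.
\<close>
lemma trunc_moment_le:
  assumes t: "0 < t" and \<sigma>: "0 < \<sigma>" and r: "0 < r" and \<delta>: "0 < \<delta>" "\<delta> \<le> 1"
  shows "(\<integral>\<omega>. min t (\<sigma> * X \<omega>) powr r \<partial>M)
       \<le> t powr r * (1 - (1 - \<delta> powr r) * small_ball (\<delta> * t / \<sigma>))"
proof -
  let ?A = "{\<omega> \<in> space M. X \<omega> \<le> \<delta> * t / \<sigma>}"
  have intA: "integrable M (indicat_real ?A)"
    by (intro integrable_real_indicator) (auto simp: emeasure_eq_measure)
  have "(\<integral>\<omega>. min t (\<sigma> * X \<omega>) powr r \<partial>M)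
      \<le> (\<integral>\<omega>. t powr r - t powr r * (1 - \<delta> powr r) * indicator ?A \<omega> \<partial>M)"
  proof (rule integral_mono_AE)
    show "AE \<omega> in M. min t (\<sigma> * X \<omega>) powr r
        \<le> t powr r - t powr r * (1 - \<delta> powr r) * indicator ?A \<omega>"
      using AE_nonneg AE_space
    proof eventually_elim
      case (elim \<omega>)
      show ?case
      proof (cases "\<omega> \<in> ?A")
        case True
        then have "\<sigma> * X \<omega> \<le> \<delta> * t" using \<sigma> by (simp add: field_simps)
        then have "min t (\<sigma> * X \<omega>) powr r \<le> (\<delta> * t) powr r"
          using elim t \<sigma> r by (intro powr_mono2) auto
        with True show ?thesis using \<delta> t by (simp add: powr_mult algebra_simps)
      next
        case False
        then have "min t (\<sigma> * X \<omega>) powr r \<le> t powr r"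
          using elim t \<sigma> r by (intro powr_mono2) auto
        with False show ?thesis by simp
      qed
    qed
    show "integrable M (\<lambda>\<omega>. t powr r - t powr r * (1 - \<delta> powr r) * indicator ?A \<omega>)"
      by (intro Bochner_Integration.integrable_diff integrable_mult_right intA) simp
  qed (use assms in \<open>auto intro: integrable_trunc_powr\<close>)
  also have "\<dots> = t powr r - t powr r * (1 - \<delta> powr r) * prob ?A"
    using intA by (subst Bochner_Integration.integral_diff) (auto simp: prob_space)
  also have "\<dots> = t powr r * (1 - (1 - \<delta> powr r) * small_ball (\<delta> * t / \<sigma>))"
    by (simp add: small_ball_def algebra_simps)
  finally show ?thesis .
qed

lemma trunc_moment_mono:
  assumes "0 \<le> s" "s \<le> t" "0 < r"
  shows "(\<integral>\<omega>. min s (X \<omega>) powr r \<partial>M) \<le> (\<integral>\<omega>. min t (X \<omega>) powr r \<partial>M)"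
proof (rule integral_mono_AE)
  show "AE \<omega> in M. min s (X \<omega>) powr r \<le> min t (X \<omega>) powr r"
    using AE_nonneg by eventually_elim (use assms in \<open>auto intro!: powr_mono2\<close>)
qed (use integrable_trunc_powr[of _ 1 r] assms in auto)

lemma trunc_moment_le_moment:
  assumes "0 \<le> t" "0 < \<sigma>" "0 < r" "integrable M (\<lambda>\<omega>. \<bar>X \<omega>\<bar> powr r)"
  shows "(\<integral>\<omega>. min t (\<sigma> * X \<omega>) powr r \<partial>M) \<le> \<sigma> powr r * moment r"
proof -
  have "(\<integral>\<omega>. min t (\<sigma> * X \<omega>) powr r \<partial>M) \<le> (\<integral>\<omega>. \<sigma> powr r * \<bar>X \<omega>\<bar> powr r \<partial>M)"
  proof (rule integral_mono_AE)
    show "AE \<omega> in M. min t (\<sigma> * X \<omega>) powr r \<le> \<sigma> powr r * \<bar>X \<omega>\<bar> powr r"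
      using AE_nonneg
      by eventually_elim (use assms in \<open>auto intro!: powr_mono2 simp flip: powr_mult\<close>)
  qed (use assms in \<open>auto intro: integrable_trunc_powr\<close>)
  then show ?thesis by simp
qed

section \<open>Decay of small ball probabilities\<close>

definition small_ball_decay :: "real \<Rightarrow> real \<Rightarrow> real \<Rightarrow> bool" where
  "small_ball_decay \<epsilon> \<tau> c \<longleftrightarrow> (\<forall>t. 0 < t \<and> t \<le> c \<longrightarrow> small_ball (\<tau> * t) \<le> \<epsilon> * small_ball t)"

lemma small_ball_decayD:
  "small_ball_decay \<epsilon> \<tau> c \<Longrightarrow> 0 < t \<Longrightarrow> t \<le> c \<Longrightarrow> small_ball (\<tau> * t) \<le> \<epsilon> * small_ball t"
  by (simp add: small_ball_decay_def)

lemma small_ball_decay_weaken: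
  assumes d: "small_ball_decay \<epsilon> \<tau> c" and "\<epsilon> \<le> \<epsilon>'" "\<tau>' \<le> \<tau>"
  shows "small_ball_decay \<epsilon>' \<tau>' c"
  unfolding small_ball_decay_def
proof (intro allI impI, elim conjE)
  fix t assume t: "0 < t" "t \<le> c"
  have "small_ball (\<tau>' * t) \<le> small_ball (\<tau> * t)"
    using assms t by (intro small_ball_mono mult_right_mono) auto
  also have "\<dots> \<le> \<epsilon> * small_ball t" using small_ball_decayD[OF d] t by blast
  also have "\<dots> \<le> \<epsilon>' * small_ball t" using assms by (intro mult_right_mono) auto
  finally show "small_ball (\<tau>' * t) \<le> \<epsilon>' * small_ball t" .
qed

lemma small_ball_decay_power:
  assumes d: "small_ball_decay \<epsilon> \<tau> c" and \<epsilon>: "0 \<le> \<epsilon>" and \<tau>: "0 < \<tau>" "\<tau> \<le> 1"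
  shows "small_ball_decay (\<epsilon> ^ k) (\<tau> ^ k) c"
  unfolding small_ball_decay_def
proof (intro allI impI, elim conjE)
  fix t assume t: "0 < t" "t \<le> c"
  show "small_ball (\<tau> ^ k * t) \<le> \<epsilon> ^ k * small_ball t"
  proof (induction k)
    case (Suc k)
    have "\<tau> ^ k * t \<le> 1 * t" using \<tau> t by (intro mult_right_mono power_le_one) auto
    then have "small_ball (\<tau> * (\<tau> ^ k * t)) \<le> \<epsilon> * small_ball (\<tau> ^ k * t)"
      using \<tau> t by (intro small_ball_decayD[OF d] mult_pos_pos zero_less_power) linarith+
    also have "\<dots> \<le> \<epsilon> * (\<epsilon> ^ k * small_ball t)"
      using Suc \<epsilon> by (intro mult_left_mono) auto
    finally show ?case by (simp add: mult.assoc)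
  qed simp
qed

text \<open>
  Any decay yields arbitrarily strong decay on an arbitrarily long interval: iterate until
  \<open>\<epsilon> ^ k < \<epsilon>'\<close>, and reach \<open>t\<close> up to \<open>c'\<close> by first shrinking it into \<open>(0, c]\<close>.
\<close>
lemma small_ball_decay_improve:
  assumes d: "small_ball_decay \<epsilon> \<tau> c" and \<epsilon>: "\<epsilon> < 1" and \<tau>: "0 < \<tau>" and c: "0 < c"
    and \<epsilon>': "0 < \<epsilon>'" and c': "0 < c'"
  shows "\<exists>\<tau>'>0. \<tau>' \<le> 1 \<and> small_ball_decay \<epsilon>' \<tau>' c'"
proof -
  \<comment> \<open>The iteration needs a nonnegative rate and a contraction; a negative \<open>\<epsilon>\<close> or \<open>\<tau> > 1\<close> only make
    the hypothesis stronger.\<close>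
  define \<epsilon>0 where "\<epsilon>0 = max \<epsilon> 0"
  define \<tau>0 where "\<tau>0 = min \<tau> 1"
  define s where "s = min 1 (c / c')"
  have 0: "0 \<le> \<epsilon>0" "\<epsilon>0 < 1" "0 < \<tau>0" "\<tau>0 \<le> 1" "0 < s" "s \<le> 1" "s * c' \<le> c"
    using \<epsilon> \<tau> c c' by (auto simp: \<epsilon>0_def \<tau>0_def s_def min_def field_simps)
  obtain k where k: "\<epsilon>0 ^ k < \<epsilon>'"
    using real_arch_pow_inv[OF \<epsilon>' 0(2)] by blast
  have "small_ball_decay \<epsilon>0 \<tau>0 c"
    by (rule small_ball_decay_weaken[OF d]) (auto simp: \<epsilon>0_def \<tau>0_def)
  then have dk: "small_ball_decay (\<epsilon>0 ^ k) (\<tau>0 ^ k) c"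
    using 0 by (intro small_ball_decay_power) auto
  have "small_ball_decay \<epsilon>' (\<tau>0 ^ k * s) c'"
    unfolding small_ball_decay_def
  proof (intro allI impI, elim conjE)
    fix t assume t: "0 < t" "t \<le> c'"
    have "s * t \<le> s * c'" using t 0 by (intro mult_left_mono) auto
    with 0 t have "small_ball (\<tau>0 ^ k * (s * t)) \<le> \<epsilon>0 ^ k * small_ball (s * t)"
      by (intro small_ball_decayD[OF dk] mult_pos_pos) linarith+
    also have "\<dots> \<le> \<epsilon>' * small_ball t"
      using k 0 t \<epsilon>' by (intro mult_mono small_ball_mono) (auto intro!: mult_left_le_one_le)
    finally show "small_ball (\<tau>0 ^ k * s * t) \<le> \<epsilon>' * small_ball t"
      by (simp add: mult.assoc)
  qed
  moreover have "0 < \<tau>0 ^ k * s" "\<tau>0 ^ k * s \<le> 1"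
    using 0 by (auto intro!: mult_le_one power_le_one)
  ultimately show ?thesis by blast
qed

section \<open>Decay and the comparison of truncated moments\<close>

text \<open>
  After division by \<open>t\<close> the \<open>q\<close>-side is at most \<open>(1 - c * u) powr (1 / q)\<close> with
  \<open>u = small_ball (t / (2 * \<sigma>))\<close> and \<open>c = 1 - 2 powr - q\<close>, while the \<open>p\<close>-side is at least
  \<open>(1 - small_ball t) powr (1 / p)\<close>. The factor \<open>s / (1 + s)\<close> is chosen so that
  \<open>1 / (1 + s * u) \<le> 1 - s / (1 + s) * u\<close> for \<open>u\<close> in \<open>[0, 1]\<close>.
\<close>
lemma trunc_comparison_small:
  assumes p: "0 < p" and q: "0 < q" and t: "0 < t" and \<sigma>: "0 < \<sigma>"
    and s: "s = p / q * (1 - (1 / 2) powr q)"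
    and le: "small_ball t \<le> s / (1 + s) * small_ball (t / (2 * \<sigma>))"
  shows "(\<integral>\<omega>. min t (\<sigma> * X \<omega>) powr q \<partial>M) powr (1 / q)
       \<le> (\<integral>\<omega>. min t (X \<omega>) powr p \<partial>M) powr (1 / p)"
proof -
  let ?u = "small_ball (t / (2 * \<sigma>))"
  define c where "c = 1 - (1 / 2) powr q"
  have c: "0 < c" "c < 1"
    using powr_less_mono2[of q "1/2" 1] q by (auto simp: c_def)
  have s0: "0 < s" and sc: "s = p / q * c" using s c p q by (auto simp: c_def)
  have u: "0 \<le> ?u" "?u \<le> 1" by simp_all
  have cu: "0 \<le> c * ?u" "c * ?u \<le> 1"
    using c u by (auto intro!: mult_le_one)
  have "(1 - c * ?u) powr (p / q) \<le> 1 / (1 + s * ?u)"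
    using one_minus_powr_le[of "c * ?u" "p / q"] cu p q by (simp add: sc mult.assoc)
  also have "\<dots> \<le> 1 - s / (1 + s) * ?u"
  proof -
    have "0 \<le> s * s * (?u * (1 - ?u))" using s0 u by auto
    then have "1 * (1 + s) \<le> (1 + s - s * ?u) * (1 + s * ?u)"
      by (simp add: algebra_simps)
    then have "1 / (1 + s * ?u) \<le> (1 + s - s * ?u) / (1 + s)"
      using s0 u by (subst frac_le_eq) (auto simp: add_pos_nonneg divide_le_0_iff)
    then show ?thesis using s0 by (simp add: diff_divide_distrib)
  qed
  also have "\<dots> \<le> 1 - small_ball t" using le by simp
  finally have key: "(1 - c * ?u) powr (p / q) \<le> 1 - small_ball t" .
  have "(\<integral>\<omega>. min t (\<sigma> * X \<omega>) powr q \<partial>M) powr (1 / q) \<le> (t powr q * (1 - c * ?u)) powr (1 / q)"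
    using trunc_moment_le[OF t \<sigma> q, of "1/2"] q by (intro powr_mono2) (auto simp: c_def)
  also have "\<dots> = t * ((1 - c * ?u) powr (p / q)) powr (1 / p)"
    using t q p cu by (simp add: powr_mult powr_powr)
  also have "\<dots> \<le> t * (1 - small_ball t) powr (1 / p)"
    using key t p by (intro mult_left_mono powr_mono2) auto
  also have "\<dots> = (t powr p * (1 - small_ball t)) powr (1 / p)"
    using t p by (simp add: powr_mult powr_powr)
  also have "\<dots> \<le> (\<integral>\<omega>. min t (X \<omega>) powr p \<partial>M) powr (1 / p)"
    using trunc_moment_ge[OF t _ p, of 1] p t by (intro powr_mono2) auto
  finally show ?thesis .
qed

text \<open>
  Up to \<open>t0 = \<tau> * c\<close> the decay applies at the point \<open>t / \<tau> \<le> c\<close>. Beyond \<open>t0\<close> the right-hand side stays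
  above its value \<open>b > 0\<close> at \<open>t0\<close>, while the left-hand side is at most \<open>\<sigma>\<close> times the \<open>q\<close>-norm of
  \<open>X\<close>; both ranges tolerate any smaller \<open>\<sigma>\<close>.
\<close>
lemma decay_imp_trunc_comparison:
  assumes p: "0 < p" and q: "0 < q" and int: "integrable M (\<lambda>\<omega>. \<bar>X \<omega>\<bar> powr q)"
    and c: "0 < c" and tail_c: "0 < tail c"
    and d: "\<And>\<epsilon>. 0 < \<epsilon> \<Longrightarrow> \<exists>\<tau>>0. \<tau> \<le> 1 \<and> small_ball_decay \<epsilon> \<tau> c"
  shows "\<exists>\<sigma>>0. \<forall>t\<ge>0. (\<integral>\<omega>. min t (\<sigma> * X \<omega>) powr q \<partial>M) powr (1 / q)
       \<le> (\<integral>\<omega>. min t (X \<omega>) powr p \<partial>M) powr (1 / p)"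
proof -
  define s where "s = p / q * (1 - (1 / 2) powr q)"
  have s: "0 < s" using powr_less_mono2[of q "1/2" 1] p q by (auto simp: s_def)
  then obtain \<tau> where \<tau>: "0 < \<tau>" "\<tau> \<le> 1" and d\<tau>: "small_ball_decay (s / (1 + s)) \<tau> c"
    using d[of "s / (1 + s)"] by auto
  define t0 where "t0 = \<tau> * c"
  have t0: "0 < t0" "t0 \<le> c" using \<tau> c by (auto simp: t0_def)
  have tail_t0: "0 < tail t0" using tail_antimono[OF t0(2)] tail_c by linarith
  define b where "b = (\<integral>\<omega>. min t0 (X \<omega>) powr p \<partial>M) powr (1 / p)"
  have "0 < t0 powr p * (1 - small_ball t0)" using t0 tail_t0 by (simp add: tail_eq)
  also have "\<dots> \<le> (\<integral>\<omega>. min t0 (X \<omega>) powr p \<partial>M)"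
    using trunc_moment_ge[OF t0(1) _ p, of 1] by simp
  finally have b: "0 < b" by (simp add: b_def)
  define \<sigma> where "\<sigma> = min (\<tau> / 2) (b / (Lnorm M q X + 1))"
  have \<sigma>: "0 < \<sigma>" "2 * \<sigma> \<le> \<tau>" and \<sigma>b: "\<sigma> * Lnorm M q X \<le> b"
  proof -
    have L: "0 < Lnorm M q X + 1" by (simp add: add_nonneg_pos)
    show "0 < \<sigma>" "2 * \<sigma> \<le> \<tau>" using \<tau> b L by (auto simp: \<sigma>_def)
    then have "\<sigma> * Lnorm M q X \<le> \<sigma> * (Lnorm M q X + 1)" by (intro mult_left_mono) auto
    also have "\<dots> \<le> b / (Lnorm M q X + 1) * (Lnorm M q X + 1)"
      using L by (intro mult_right_mono) (auto simp: \<sigma>_def)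
    finally show "\<sigma> * Lnorm M q X \<le> b" using L by simp
  qed
  have "(\<integral>\<omega>. min t (\<sigma> * X \<omega>) powr q \<partial>M) powr (1 / q)
       \<le> (\<integral>\<omega>. min t (X \<omega>) powr p \<partial>M) powr (1 / p)" if t: "0 \<le> t" for t
  proof -
    consider "t = 0" | "0 < t" "t \<le> t0" | "t0 < t" using t by linarith
    then show ?thesis
    proof cases
      case 1
      have "(\<integral>\<omega>. min 0 (\<sigma> * X \<omega>) powr q \<partial>M) = (\<integral>\<omega>. 0 \<partial>M)"
        by (rule integral_cong_AE) (use AE_nonneg \<sigma> in \<open>auto elim!: eventually_mono simp: min_def\<close>)
      with 1 show ?thesis by simp
    next
      case 2
      have "small_ball t = small_ball (\<tau> * (t / \<tau>))" using \<tau> by simp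
      also have "\<dots> \<le> s / (1 + s) * small_ball (t / \<tau>)"
        using 2 \<tau> by (intro small_ball_decayD[OF d\<tau>]) (auto simp: t0_def field_simps)
      also have "\<dots> \<le> s / (1 + s) * small_ball (t / (2 * \<sigma>))"
        using 2 \<sigma> s by (intro mult_left_mono small_ball_mono divide_left_mono) auto
      finally show ?thesis
        using trunc_comparison_small[OF p q 2(1) \<sigma>(1) s_def] by simp
    next
      case 3
      have "(\<integral>\<omega>. min t (\<sigma> * X \<omega>) powr q \<partial>M) powr (1 / q) \<le> (\<sigma> powr q * moment q) powr (1 / q)"
        using trunc_moment_le_moment[OF t \<sigma>(1) q int] q by (intro powr_mono2) auto
      also have "\<dots> = \<sigma> * Lnorm M q X"
        using q \<sigma> by (simp add: powr_mult powr_powr Lnorm_def)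
      also have "\<dots> \<le> b" by (rule \<sigma>b)
      also have "\<dots> \<le> (\<integral>\<omega>. min t (X \<omega>) powr p \<partial>M) powr (1 / p)"
        unfolding b_def using 3 t0 p by (intro powr_mono2 trunc_moment_mono) auto
      finally show ?thesis .
    qed
  qed
  with \<sigma>(1) show ?thesis by blast
qed

text \<open>
  With \<open>r = q / p\<close> and \<open>w = (1 - \<delta> powr p) * small_ball (\<delta> * t)\<close>, the comparison at \<open>t = \<sigma> * u\<close> reads
  \<open>1 - small_ball u \<le> (1 - w) powr r\<close>. As long as \<open>w\<close> stays below some \<open>v0 < 1\<close>, the right-hand side
  is at most \<open>1 - \<kappa> * w\<close> with \<open>\<kappa> > 1\<close>. The value of \<open>\<delta>\<close> makes \<open>(1 - \<delta> powr p) * \<kappa>\<close> the midpoint of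
  1 and \<open>\<kappa>\<close>, so it is still above 1 and its inverse serves as the decay rate.
\<close>
lemma trunc_comparison_imp_decay:
  assumes p: "0 < p" and pq: "p < q" and \<sigma>: "0 < \<sigma>"
    and t0: "0 < t0" and tail_t0: "0 < tail t0"
    and comp: "\<And>t. 0 \<le> t \<Longrightarrow> (\<integral>\<omega>. min t (\<sigma> * X \<omega>) powr q \<partial>M) powr (1 / q)
       \<le> (\<integral>\<omega>. min t (X \<omega>) powr p \<partial>M) powr (1 / p)"
  shows "\<exists>\<epsilon><1. \<exists>\<tau>>0. small_ball_decay \<epsilon> \<tau> (t0 / \<sigma>)"
proof -
  define r where "r = q / p"
  define v0 where "v0 = small_ball t0"
  define \<kappa> where "\<kappa> = r / (1 + (r - 1) * v0)"
  define \<delta> where "\<delta> = ((1 - 1 / \<kappa>) / 2) powr (1 / p)"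
  have q: "0 < q" using p pq by simp
  have r: "1 < r" using p pq by (simp add: r_def)
  have v0: "0 \<le> v0" "v0 < 1" using tail_t0 by (auto simp: v0_def tail_eq)
  have den: "0 < 1 + (r - 1) * v0" using r v0 by (simp add: add_pos_nonneg)
  have "(r - 1) * v0 < (r - 1) * 1" using r v0 by (intro mult_strict_left_mono) auto
  then have \<kappa>: "1 < \<kappa>" using den by (simp add: \<kappa>_def field_simps)
  have \<delta>p: "\<delta> powr p = (1 - 1 / \<kappa>) / 2" using \<kappa> p by (simp add: \<delta>_def powr_powr)
  have \<delta>: "0 < \<delta>" "\<delta> \<le> 1"
    using \<kappa> p by (auto simp: \<delta>_def field_simps intro!: powr_le1)
  have \<epsilon>: "(1 - \<delta> powr p) * \<kappa> = (\<kappa> + 1) / 2" using \<kappa> by (simp add: \<delta>p field_simps)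
  have "small_ball (\<delta> * \<sigma> * u) \<le> 2 / (\<kappa> + 1) * small_ball u" if u: "0 < u" "u \<le> t0 / \<sigma>" for u
  proof -
    define t where "t = \<sigma> * u"
    have t: "0 < t" "t \<le> t0" using u \<sigma> by (auto simp: t_def field_simps)
    define w where "w = (1 - \<delta> powr p) * small_ball (\<delta> * t)"
    have dp: "0 \<le> 1 - \<delta> powr p" "1 - \<delta> powr p \<le> 1" using \<kappa> by (auto simp: \<delta>p field_simps)
    have "\<delta> * t \<le> t0" using \<delta> t mult_left_le_one_le[of t \<delta>] by linarith
    then have "small_ball (\<delta> * t) \<le> v0" unfolding v0_def by (rule small_ball_mono)
    then have w: "0 \<le> w" "w \<le> v0"
      using dp mult_left_le_one_le[of "small_ball (\<delta> * t)" "1 - \<delta> powr p"]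
      by (auto simp: w_def)
    have "t * (1 - small_ball u) powr (1 / q) = (t powr q * (1 - small_ball (t / \<sigma>))) powr (1 / q)"
      using u q \<sigma> by (simp add: powr_mult powr_powr t_def)
    also have "\<dots> \<le> (\<integral>\<omega>. min t (\<sigma> * X \<omega>) powr q \<partial>M) powr (1 / q)"
      using q t trunc_moment_ge[OF t(1) \<sigma> q] by (intro powr_mono2) auto
    also have "\<dots> \<le> (\<integral>\<omega>. min t (X \<omega>) powr p \<partial>M) powr (1 / p)"
      using comp t by simp
    also have "\<dots> \<le> (t powr p * (1 - w)) powr (1 / p)"
      using p trunc_moment_le[OF t(1) _ p \<delta>, of 1] by (intro powr_mono2) (auto simp: w_def)
    also have "\<dots> = t * (1 - w) powr (1 / p)"
      using t p w v0 by (simp add: powr_mult powr_powr)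
    finally have "(1 - small_ball u) powr (1 / q) \<le> (1 - w) powr (1 / p)"
      using t by simp
    then have "((1 - small_ball u) powr (1 / q)) powr q \<le> ((1 - w) powr (1 / p)) powr q"
      using q by (intro powr_mono2) auto
    then have "1 - small_ball u \<le> (1 - w) powr r"
      using q by (simp add: powr_powr r_def)
    also have "\<dots> = (1 - w) * (1 - w) powr (r - 1)"
      using powr_mult_base[of "1 - w" "r - 1"] w v0 by simp
    also have "\<dots> \<le> (1 - w) * (1 / (1 + (r - 1) * w))"
      using w v0 r by (intro mult_left_mono one_minus_powr_le) auto
    also have "\<dots> = 1 - r / (1 + (r - 1) * w) * w"
    proof -
      have "0 < 1 + (r - 1) * w" using r w by (simp add: add_pos_nonneg)
      then show ?thesis by (simp add: field_simps)
    qed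
    also have "\<dots> \<le> 1 - \<kappa> * w"
      unfolding \<kappa>_def using r w v0 den
      by (intro diff_left_mono mult_right_mono divide_left_mono) (auto intro!: mult_left_mono mult_pos_pos add_pos_nonneg)
    finally have "\<kappa> * w \<le> small_ball u" by simp
    moreover have "\<kappa> * w = (\<kappa> + 1) / 2 * small_ball (\<delta> * t)"
      by (simp add: w_def flip: \<epsilon>)
    ultimately have "(\<kappa> + 1) / 2 * small_ball (\<delta> * t) \<le> small_ball u" by simp
    then show ?thesis using \<kappa> by (simp add: t_def field_simps)
  qed
  then have "small_ball_decay (2 / (\<kappa> + 1)) (\<delta> * \<sigma>) (t0 / \<sigma>)"
    by (simp add: small_ball_decay_def)
  moreover have "2 / (\<kappa> + 1) < 1" "0 < \<delta> * \<sigma>" using \<kappa> \<delta> \<sigma> by auto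
  ultimately show ?thesis by blast
qed

section \<open>Decay and the comparison of moments of minima\<close>

lemma tail_le_tail_power2:
  assumes d: "small_ball_decay (1 / 2) \<tau> c" and t: "0 < t" "t \<le> c"
  shows "tail t \<le> (tail (\<tau> * t))\<^sup>2"
proof -
  have "2 * small_ball (\<tau> * t) \<le> small_ball t" using small_ball_decayD[OF d t] by simp
  then have "tail t \<le> 1 - 2 * small_ball (\<tau> * t)" by (simp add: tail_eq)
  also have "\<dots> \<le> (tail (\<tau> * t))\<^sup>2" by (simp add: tail_eq power2_eq_square algebra_simps)
  finally show ?thesis .
qed

text \<open>
  The layer cake integral of the \<open>q\<close>-th moment is cut at the level \<open>T = c powr q\<close>. Below \<open>T\<close> the
  squaring argument applies, with \<open>B\<close> the level from which on the Markov inequality forces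
  \<open>H \<le> \<kappa> / 2\<close>. The part above \<open>T\<close> is at most \<open>tail c ^ (n - 1)\<close> times the \<open>q\<close>-th moment of \<open>X\<close>, whereas
  the part below is at least \<open>T * tail c ^ n\<close>; hence their ratio is bounded uniformly in \<open>n\<close>.
\<close>
lemma min_copies_moment_le:
  assumes p: "0 < p" and pq: "p < q" and int: "integrable M (\<lambda>\<omega>. \<bar>X \<omega>\<bar> powr q)"
    and c: "0 < c" and tail_c: "0 < tail c"
    and \<tau>: "0 < \<tau>" "\<tau> \<le> 1" and d: "small_ball_decay (1 / 2) \<tau> c"
    and n: "1 \<le> n"
  defines "A \<equiv> \<integral>\<omega>. \<bar>min_copies n X \<omega>\<bar> powr p \<partial>copy_space n M"
  shows "(\<integral>\<omega>. \<bar>min_copies n X \<omega>\<bar> powr q \<partial>copy_space n M)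
       \<le> (1 + moment q / (c powr q * tail c)) * (2 / \<tau> powr q * (2 / \<tau> powr q) powr (q / p)) * A powr (q / p)"
proof -
  interpret Y: nonneg_rv "copy_space n M" "min_copies n X" by (rule min_copies_rv[OF n])
  have Ytail: "Y.tail t = tail t ^ n" for t by (rule min_copies_rv[OF n])
  have q: "0 < q" using p pq by simp
  have Yint: "integrable (copy_space n M) (\<lambda>\<omega>. \<bar>min_copies n X \<omega>\<bar> powr q)"
    by (rule integrable_min_copies_powr[OF n q int])
  have Yintp: "integrable (copy_space n M) (\<lambda>\<omega>. \<bar>min_copies n X \<omega>\<bar> powr p)"
    using Y.integrable_powr_le[OF p _ Yint] pq by simp
  define \<kappa> where "\<kappa> = \<tau> powr q"
  define T where "T = c powr q"
  define B where "B = (2 * A / \<kappa>) powr (q / p)"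
  define H where "H u = tail (u powr (1 / q)) ^ n" for u
  have \<kappa>: "0 < \<kappa>" "\<kappa> \<le> 1" using \<tau> q by (auto simp: \<kappa>_def intro: powr_le1)
  have T: "0 < T" using c by (simp add: T_def)
  have A: "0 \<le> A" by (simp add: A_def)
  have T_root: "T powr (1 / q) = c" using c q by (simp add: T_def powr_powr)
  have [measurable]: "H \<in> borel_measurable borel" unfolding H_def by measurable
  have body: "(\<integral>\<^sup>+u. ennreal (H u) * indicator {0<..<T} u \<partial>lborel) \<le> ennreal (2 * B / \<kappa>)"
  proof (rule nn_integral_le_of_squaring)
    show "0 \<le> H u" "H u \<le> 1" for u by (auto simp: H_def intro: power_le_one)
    show "H (v / \<kappa>) \<le> (H v)\<^sup>2" if v: "0 < v" "v < \<kappa> * T" for v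
    proof -
      have root: "(v / \<kappa>) powr (1 / q) = v powr (1 / q) / \<tau>"
        using v \<kappa> \<tau> q by (simp add: powr_divide \<kappa>_def powr_powr)
      have "v / \<kappa> \<le> T" using v \<kappa> by (simp add: field_simps)
      then have "(v / \<kappa>) powr (1 / q) \<le> c"
        unfolding T_root[symmetric] using v \<kappa> q by (intro powr_mono2) auto
      then have "tail (v powr (1 / q) / \<tau>) \<le> (tail (v powr (1 / q)))\<^sup>2"
        using tail_le_tail_power2[OF d, of "v powr (1 / q) / \<tau>"] v \<tau> by (simp add: root)
      then have "H (v / \<kappa>) \<le> ((tail (v powr (1 / q)))\<^sup>2) ^ n"
        unfolding H_def root by (intro power_mono) auto
      also have "\<dots> = (H v)\<^sup>2" unfolding H_def by (metis power_mult mult.commute)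
      finally show ?thesis .
    qed
    show "H v \<le> \<kappa> / 2" if v: "B < v" for v
    proof -
      have v0: "0 < v" using v by (smt (verit) B_def powr_ge_zero)
      have "(2 * A / \<kappa>) powr (q / p) < (v powr (p / q)) powr (q / p)"
        using v v0 p q by (simp add: B_def powr_powr)
      then have "2 * A / \<kappa> \<le> v powr (p / q)"
        using p q by (smt (verit) divide_pos_pos powr_ge_zero powr_mono2)
      then have "A \<le> \<kappa> / 2 * v powr (p / q)" using \<kappa> by (simp add: field_simps)
      moreover have "v powr (p / q) * H v \<le> A"
        using Y.tail_Markov[OF p _ Yintp, of "v powr (1 / q)"] v0
        by (simp add: H_def Ytail A_def powr_powr)
      ultimately have "v powr (p / q) * H v \<le> v powr (p / q) * (\<kappa> / 2)" by (simp add: mult.commute)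
      then show ?thesis using v0 by simp
    qed
  qed (use \<kappa> T in \<open>auto simp: B_def\<close>)
  have "ennreal (T * tail c ^ n) = (\<integral>\<^sup>+u. ennreal (tail c ^ n) * indicator {0<..<T} u \<partial>lborel)"
    using T by (subst nn_integral_cmult_indicator) (auto simp: ennreal_mult mult.commute)
  also have "\<dots> \<le> (\<integral>\<^sup>+u. ennreal (H u) * indicator {0<..<T} u \<partial>lborel)"
  proof (intro nn_integral_mono)
    fix u :: real
    have "tail c ^ n \<le> H u" if "0 < u" "u < T"
    proof -
      have "u powr (1 / q) \<le> c" unfolding T_root[symmetric] using that q by (intro powr_mono2) auto
      then show ?thesis unfolding H_def by (intro power_mono tail_antimono) auto
    qed
    then show "ennreal (tail c ^ n) * indicator {0<..<T} u \<le> ennreal (H u) * indicator {0<..<T} u"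
      by (auto simp: indicator_def intro: ennreal_leI)
  qed
  also note body
  finally have Tn: "T * tail c ^ n \<le> 2 * B / \<kappa>"
    using \<kappa> by (subst (asm) ennreal_le_iff) (auto simp: B_def)
  have rest: "(\<integral>\<^sup>+u. ennreal (H u) * indicator {T..} u \<partial>lborel) \<le> ennreal (tail c ^ (n - 1) * moment q)"
  proof -
    have "(\<integral>\<^sup>+u. ennreal (H u) * indicator {T..} u \<partial>lborel)
        \<le> (\<integral>\<^sup>+u. ennreal (tail c ^ (n - 1)) * (ennreal (tail (u powr (1 / q))) * indicator {0<..} u) \<partial>lborel)"
    proof (intro nn_integral_mono)
      fix u :: real
      show "ennreal (H u) * indicator {T..} u
          \<le> ennreal (tail c ^ (n - 1)) * (ennreal (tail (u powr (1 / q))) * indicator {0<..} u)"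
      proof (cases "T \<le> u")
        case True
        then have "c \<le> u powr (1 / q)" unfolding T_root[symmetric] using T q by (intro powr_mono2) auto
        then have "tail (u powr (1 / q)) ^ (n - 1) \<le> tail c ^ (n - 1)"
          by (intro power_mono tail_antimono) auto
        then have "H u \<le> tail c ^ (n - 1) * tail (u powr (1 / q))"
          using n unfolding H_def
          by (subst power_eq_if) (auto simp: mult.commute intro!: mult_left_mono)
        then show ?thesis using True T by (simp add: ennreal_leI flip: ennreal_mult)
      qed simp
    qed
    also have "\<dots> = ennreal (tail c ^ (n - 1)) * (\<integral>\<^sup>+\<omega>. ennreal (\<bar>X \<omega>\<bar> powr q) \<partial>M)"
      unfolding moment_layer_cake[OF q] by (rule nn_integral_cmult) measurable
    also have "(\<integral>\<^sup>+\<omega>. ennreal (\<bar>X \<omega>\<bar> powr q) \<partial>M) = ennreal (moment q)"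
      by (rule nn_integral_eq_integral[OF int]) simp
    finally show ?thesis by (simp add: ennreal_mult)
  qed
  have "ennreal (\<integral>\<omega>. \<bar>min_copies n X \<omega>\<bar> powr q \<partial>copy_space n M)
      = (\<integral>\<^sup>+u. ennreal (H u) * indicator {0<..} u \<partial>lborel)"
    unfolding H_def Y.moment_layer_cake[OF q, unfolded Ytail, symmetric]
    by (rule nn_integral_eq_integral[OF Yint, symmetric]) simp
  also have "\<dots> = (\<integral>\<^sup>+u. ennreal (H u) * indicator {0<..<T} u + ennreal (H u) * indicator {T..} u \<partial>lborel)"
    using T by (intro nn_integral_cong) (auto simp: indicator_def)
  also have "\<dots> = (\<integral>\<^sup>+u. ennreal (H u) * indicator {0<..<T} u \<partial>lborel)
      + (\<integral>\<^sup>+u. ennreal (H u) * indicator {T..} u \<partial>lborel)"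
    by (rule nn_integral_add) measurable
  also have "\<dots> \<le> ennreal (2 * B / \<kappa>) + ennreal (tail c ^ (n - 1) * moment q)"
    by (intro add_mono body rest)
  also have "\<dots> = ennreal (2 * B / \<kappa> + tail c ^ (n - 1) * moment q)"
    using \<kappa> by (intro ennreal_plus[symmetric]) (auto simp: B_def)
  finally have "(\<integral>\<omega>. \<bar>min_copies n X \<omega>\<bar> powr q \<partial>copy_space n M) \<le> 2 * B / \<kappa> + tail c ^ (n - 1) * moment q"
    using \<kappa> by (subst (asm) ennreal_le_iff) (auto simp: B_def intro!: add_nonneg_nonneg)
  also have "tail c ^ (n - 1) * moment q = moment q / (T * tail c) * (T * tail c ^ n)"
    using n T tail_c by (cases n) auto
  also have "\<dots> \<le> moment q / (T * tail c) * (2 * B / \<kappa>)"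
    using Tn T tail_c by (intro mult_left_mono) auto
  also have "2 * B / \<kappa> + \<dots> = (1 + moment q / (T * tail c)) * (2 / \<kappa> * B)"
    by (simp add: algebra_simps)
  also have "B = (2 / \<kappa>) powr (q / p) * A powr (q / p)"
    using \<kappa> A unfolding B_def by (subst powr_mult[symmetric]) auto
  finally show ?thesis by (simp add: \<kappa>_def T_def mult.assoc)
qed

lemma decay_imp_min_copies_comparison:
  assumes p: "0 < p" and pq: "p < q" and int: "integrable M (\<lambda>\<omega>. \<bar>X \<omega>\<bar> powr q)"
    and c: "0 < c" and tail_c: "0 < tail c"
    and \<tau>: "0 < \<tau>" "\<tau> \<le> 1" and d: "small_ball_decay (1 / 2) \<tau> c"
  shows "\<exists>C. \<forall>n\<ge>1. Lnorm (copy_space n M) q (min_copies n X)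
       \<le> C * Lnorm (copy_space n M) p (min_copies n X)"
proof -
  define E where "E = (1 + moment q / (c powr q * tail c)) * (2 / \<tau> powr q * (2 / \<tau> powr q) powr (q / p))"
  have E: "0 \<le> E" using tail_c by (auto simp: E_def)
  have "Lnorm (copy_space n M) q (min_copies n X)
      \<le> E powr (1 / q) * Lnorm (copy_space n M) p (min_copies n X)" if n: "1 \<le> n" for n
  proof -
    let ?A = "\<integral>\<omega>. \<bar>min_copies n X \<omega>\<bar> powr p \<partial>copy_space n M"
    have "Lnorm (copy_space n M) q (min_copies n X) \<le> (E * ?A powr (q / p)) powr (1 / q)"
      unfolding Lnorm_def E_def
      using p pq by (intro powr_mono2 min_copies_moment_le[OF p pq int c tail_c \<tau> d n]) auto
    also have "\<dots> = E powr (1 / q) * Lnorm (copy_space n M) p (min_copies n X)"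
      using E p pq by (simp add: Lnorm_def powr_mult powr_powr)
    finally show ?thesis .
  qed
  then show ?thesis by blast
qed

text \<open>
  Split according to whether \<open>X\<close> is at most \<open>s\<close>, between \<open>s\<close> and \<open>R * a\<close>, or above \<open>R * a\<close>, where \<open>a\<close>
  is the \<open>p\<close>-norm. The first part contributes at most a quarter of \<open>a powr p\<close> by the choice of \<open>s\<close>, the last
  one at most another quarter by the choice of \<open>R\<close> and the bound on the \<open>q\<close>-norm, so the middle part,
  which is at most \<open>(R * a) powr p * tail s\<close>, carries the remaining half.
\<close>
lemma Paley_Zygmund:
  assumes p: "0 < p" and pq: "p < q" and int: "integrable M (\<lambda>\<omega>. \<bar>X \<omega>\<bar> powr q)"
    and pos: "0 < Lnorm M p X" and C: "0 < C" and le: "Lnorm M q X \<le> C * Lnorm M p X"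
  shows "1 / (2 * (4 * C powr q) powr (p / (q - p))) \<le> tail ((1 / 4) powr (1 / p) * Lnorm M p X)"
proof -
  define a where "a = Lnorm M p X"
  define s where "s = (1 / 4) powr (1 / p) * a"
  define R where "R = (4 * C powr q) powr (1 / (q - p))"
  have q: "0 < q" using p pq by simp
  have a: "0 < a" using pos by (simp add: a_def)
  have s: "0 < s" using a by (simp add: s_def)
  have R: "0 < R" using C by (simp add: R_def)
  have intp: "integrable M (\<lambda>\<omega>. \<bar>X \<omega>\<bar> powr p)" using integrable_powr_le[OF p _ int] pq by simp
  have sp: "s powr p = a powr p / 4" using a p by (simp add: s_def powr_mult powr_powr)
  have Rpq: "R powr (p - q) * C powr q = 1 / 4"
  proof -
    have "R powr (q - p) = 4 * C powr q" using C pq by (simp add: R_def powr_powr)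
    moreover have "R powr (p - q) = 1 / R powr (q - p)"
      using powr_minus_divide[of R "q - p"] by simp
    ultimately show ?thesis using C by simp
  qed
  let ?A = "{\<omega> \<in> space M. s < X \<omega>}"
  have intA: "integrable M (indicat_real ?A)"
    by (intro integrable_real_indicator) (auto simp: emeasure_eq_measure)
  have "a powr p = moment p" using p by (simp add: a_def Lnorm_powr)
  also have "\<dots> \<le> (\<integral>\<omega>. s powr p + (R * a) powr p * indicator ?A \<omega> + (R * a) powr (p - q) * \<bar>X \<omega>\<bar> powr q \<partial>M)"
  proof (rule integral_mono_AE)
    show "AE \<omega> in M. \<bar>X \<omega>\<bar> powr p
        \<le> s powr p + (R * a) powr p * indicator ?A \<omega> + (R * a) powr (p - q) * \<bar>X \<omega>\<bar> powr q"
      using AE_nonneg AE_space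
    proof eventually_elim
      case (elim \<omega>)
      consider "X \<omega> \<le> s" | "s < X \<omega>" "X \<omega> \<le> R * a" | "s < X \<omega>" "R * a < X \<omega>" by linarith
      then show ?case
      proof cases
        case 1
        then have "\<bar>X \<omega>\<bar> powr p \<le> s powr p" using elim p by (intro powr_mono2) auto
        then show ?thesis by (intro add_increasing2) auto
      next
        case 2
        then have "\<bar>X \<omega>\<bar> powr p \<le> (R * a) powr p" using elim p by (intro powr_mono2) auto
        then show ?thesis using 2 elim by (intro add_increasing2 add_increasing) auto
      next
        case 3
        have "\<bar>X \<omega>\<bar> powr p = \<bar>X \<omega>\<bar> powr (p - q) * \<bar>X \<omega>\<bar> powr q"
          by (simp flip: powr_add)
        also have "\<dots> \<le> (R * a) powr (p - q) * \<bar>X \<omega>\<bar> powr q"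
          using 3 elim R a pq by (intro mult_right_mono powr_mono2') auto
        finally show ?thesis by (intro add_increasing) auto
      qed
    qed
  qed (use int intp intA in auto)
  also have "\<dots> = s powr p + (R * a) powr p * tail s + (R * a) powr (p - q) * moment q"
    using int intA by (simp add: tail_def prob_space)
  also have "\<dots> \<le> a powr p / 4 + R powr p * a powr p * tail s + a powr p / 4"
  proof -
    have "moment q = Lnorm M q X powr q" using q by (simp add: Lnorm_powr)
    also have "\<dots> \<le> (C * a) powr q" using le q by (intro powr_mono2) (auto simp: a_def)
    finally have "(R * a) powr (p - q) * moment q \<le> (R * a) powr (p - q) * (C * a) powr q"
      by (intro mult_left_mono) auto
    also have "\<dots> = (R powr (p - q) * C powr q) * (a powr (p - q) * a powr q)"
      using R a C by (simp add: powr_mult)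
    also have "\<dots> = a powr p / 4"
      unfolding Rpq by (simp flip: powr_add)
    finally show ?thesis using R a by (simp add: sp powr_mult)
  qed
  finally have "a powr p * (1 / 2) \<le> a powr p * (R powr p * tail s)" by (simp add: algebra_simps)
  then have "1 / 2 \<le> R powr p * tail s" using a by simp
  then have "1 / (2 * R powr p) \<le> tail s" using R by (simp add: field_simps)
  then show ?thesis by (simp add: R_def powr_powr s_def a_def)
qed

text \<open>
  With \<open>a n\<close> the \<open>p\<close>-norm of the minimum of \<open>n\<close> copies, \<open>small_ball (\<theta> * a n) \<le> L / n\<close>, and
  \<open>small_ball (K * a n)\<close> is at least \<open>4 * L / n\<close> or larger than \<open>1 / 2\<close>. For given \<open>t\<close> the least \<open>n > N\<close>
  with \<open>K * a n \<le> t\<close> gives \<open>\<theta> / K * t < \<theta> * a (n - 1)\<close>, and passing from \<open>n\<close> to \<open>n - 1\<close> costs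
  at most a factor 2. If there is no such \<open>n\<close>, then \<open>\<theta> / K * t < \<theta> * a n\<close> for all \<open>n > N\<close>, which
  forces \<open>small_ball (\<theta> / K * t) = 0\<close>.
\<close>
lemma min_copies_comparison_imp_decay:
  assumes p: "0 < p" and pq: "p < q" and int: "integrable M (\<lambda>\<omega>. \<bar>X \<omega>\<bar> powr q)"
    and pos: "0 < Lnorm M p X"
    and C: "0 < C"
    and comp: "\<And>n. 1 \<le> n \<Longrightarrow> Lnorm (copy_space n M) q (min_copies n X)
       \<le> C * Lnorm (copy_space n M) p (min_copies n X)"
  shows "\<exists>\<tau>>0. \<exists>c>0. small_ball_decay (1 / 2) \<tau> c"
proof -
  define a where "a n = Lnorm (copy_space n M) p (min_copies n X)" for n
  define \<eta> where "\<eta> = 1 / (2 * (4 * C powr q) powr (p / (q - p)))"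
  define \<theta> where "\<theta> = (1 / 4 :: real) powr (1 / p)"
  define L where "L = - ln \<eta>"
  \<comment> \<open>This makes \<open>K powr p = exp (8 * L)\<close>; of the factor \<open>8 = 2 * 2 * 2\<close>, one 2 is lost in
    \<open>1 - f \<ge> exp (- 2 * f)\<close>, one in passing from \<open>n\<close> to \<open>n - 1\<close>, and one gives the decay rate \<open>1 / 2\<close>.\<close>
  define K where "K = exp (8 * L / p)"
  have q: "0 < q" using p pq by simp
  have \<eta>: "0 < \<eta>" using C by (simp add: \<eta>_def)
  have \<theta>: "0 < \<theta>" by (simp add: \<theta>_def)
  have K: "0 < K" by (simp add: K_def)
  have intp: "integrable M (\<lambda>\<omega>. \<bar>X \<omega>\<bar> powr p)" using integrable_powr_le[OF p _ int] pq by simp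
  have tail_half: "0 < tail (Lnorm M p X / 2)" by (rule tail_half_Lnorm_pos[OF p intp pos])
  have a: "0 < a n" and eta_le: "\<eta> \<le> tail (\<theta> * a n) ^ n" and Markov: "K powr p * tail (K * a n) ^ n \<le> 1"
    if n: "1 \<le> n" for n
  proof -
    interpret Y: nonneg_rv "copy_space n M" "min_copies n X" by (rule min_copies_rv[OF n])
    have Ytail: "Y.tail t = tail t ^ n" for t by (rule min_copies_rv[OF n])
    note Yint = integrable_min_copies_powr[OF n _ int, OF q]
    note Yintp = integrable_min_copies_powr[OF n _ intp, OF p]
    show an: "0 < a n"
      unfolding a_def using pos tail_half by (intro Y.Lnorm_pos[OF _ _ p Yintp, of "Lnorm M p X / 2"]) (auto simp: Ytail)
    show "\<eta> \<le> tail (\<theta> * a n) ^ n"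
      using Y.Paley_Zygmund[OF p pq Yint _ C comp[OF n]] an by (simp add: Ytail \<eta>_def \<theta>_def a_def)
    have "(K * a n) powr p * tail (K * a n) ^ n \<le> a n powr p"
      using Y.tail_Markov[OF p _ Yintp, of "K * a n"] K an p by (simp add: Ytail Y.Lnorm_powr a_def)
    then have "a n powr p * (K powr p * tail (K * a n) ^ n) \<le> a n powr p * 1"
      using K an by (simp add: powr_mult mult.assoc mult.left_commute)
    then show "K powr p * tail (K * a n) ^ n \<le> 1" using an by simp
  qed
  have "\<eta> \<le> 1" using eta_le[of 1] tail_le_1[of "\<theta> * a 1"] by (simp del: tail_le_1)
  then have L: "0 \<le> L" using \<eta> by (simp add: L_def)
  have upper: "n * small_ball (\<theta> * a n) \<le> L" if n: "1 \<le> n" for n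
  proof -
    have "\<eta> \<le> exp (- small_ball (\<theta> * a n)) ^ n"
      using exp_ge_add_one_self[of "- small_ball (\<theta> * a n)"]
      by (intro order.trans[OF eta_le[OF n]] power_mono) (auto simp: tail_eq)
    then have "ln \<eta> \<le> ln (exp (- (n * small_ball (\<theta> * a n))))"
      using \<eta> by (subst ln_le_cancel_iff) (auto simp flip: exp_of_nat_mult)
    then show ?thesis by (simp add: L_def)
  qed
  have lower: "4 * L \<le> n * small_ball (K * a n)" if n: "1 \<le> n" and half: "small_ball (K * a n) \<le> 1 / 2" for n
  proof -
    let ?f = "small_ball (K * a n)"
    have "?f\<^sup>2 \<le> ?f * (1 / 2)" unfolding power2_eq_square using half by (intro mult_left_mono) auto
    then have "- 2 * ?f \<le> ln (1 - ?f)" using ln_one_minus_pos_lower_bound[of ?f] half by simp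
    then have "exp (- 2 * ?f) \<le> 1 - ?f" using half by (subst (asm) ln_ge_iff) auto
    then have "exp (- 2 * ?f) ^ n \<le> tail (K * a n) ^ n" by (intro power_mono) (auto simp: tail_eq)
    then have "exp (8 * L) * exp (- 2 * ?f) ^ n \<le> exp (8 * L) * tail (K * a n) ^ n" by (intro mult_left_mono) auto
    also have "\<dots> \<le> 1" using Markov[OF n] p by (simp add: K_def powr_def)
    finally have "exp (8 * L - 2 * (n * ?f)) \<le> 1"
      by (simp add: mult_exp_exp algebra_simps flip: exp_of_nat_mult)
    then show ?thesis by simp
  qed
  \<comment> \<open>From \<open>N\<close> on, \<open>L / n \<le> 1 / 4\<close>, which settles the case \<open>small_ball (K * a n) > 1 / 2\<close>.\<close>
  obtain N :: nat where N: "1 \<le> N" "4 * L \<le> N"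
    using real_arch_simple[of "max 1 (4 * L)"] by auto
  define c where "c = K * a N / 2"
  have "small_ball (\<theta> / K * t) \<le> 1 / 2 * small_ball t" if t: "0 < t" "t \<le> c" for t
  proof (cases "\<exists>n>N. K * a n \<le> t")
    case True
    define n where "n = (LEAST n. N < n \<and> K * a n \<le> t)"
    have n: "N < n" "K * a n \<le> t" using LeastI_ex[OF True] by (auto simp: n_def)
    obtain m where m: "n = Suc m" using n by (cases n) auto
    have mN: "N \<le> m" using n m by simp
    have tm: "t < K * a m"
    proof (cases "m = N")
      case True
      have "0 < K * a N" using K a N by simp
      with True t show ?thesis by (simp add: c_def)
    next
      case False
      then show ?thesis using not_less_Least[of m "\<lambda>n. N < n \<and> K * a n \<le> t"] mN m by (auto simp: n_def)
    qed
    have m0: "1 \<le> m" "4 * L \<le> m" using mN N by auto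
    have "small_ball (\<theta> / K * t) \<le> small_ball (\<theta> * a m)"
      using tm K \<theta> by (intro small_ball_mono) (simp add: field_simps)
    then have "m * small_ball (\<theta> / K * t) \<le> L"
      using upper[OF m0(1)] mult_left_mono[of _ _ "real m"] by (meson of_nat_0_le_iff order.trans)
    moreover have "L \<le> m * (1 / 2 * small_ball (K * a n))"
    proof (cases "small_ball (K * a n) \<le> 1 / 2")
      case True
      have "4 * L \<le> n * small_ball (K * a n)" using lower True n by simp
      also have "\<dots> \<le> (2 * m) * small_ball (K * a n)" using m m0 by (intro mult_right_mono) auto
      finally show ?thesis using L by simp
    next
      case False
      then have "m * (1 / 4) \<le> m * (1 / 2 * small_ball (K * a n))" by (intro mult_left_mono) auto
      then show ?thesis using m0(2) by linarith
    qed
    ultimately have "m * small_ball (\<theta> / K * t) \<le> m * (1 / 2 * small_ball (K * a n))" by linarith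
    then have "small_ball (\<theta> / K * t) \<le> 1 / 2 * small_ball (K * a n)" using m0 by simp
    also have "\<dots> \<le> 1 / 2 * small_ball t" using small_ball_mono[OF n(2)] by simp
    finally show ?thesis .
  next
    case False
    have "n * small_ball (\<theta> / K * t) \<le> L" if "N < n" for n
    proof -
      have "small_ball (\<theta> / K * t) \<le> small_ball (\<theta> * a n)"
        using False that K \<theta> by (intro small_ball_mono) (auto simp: field_simps not_le)
      then show ?thesis
        using upper[of n] that mult_left_mono[of _ _ "real n"] by (meson less_imp_le_nat N(1) of_nat_0_le_iff order.trans)
    qed
    note bound = this
    have "small_ball (\<theta> / K * t) \<le> 0"
    proof (rule ccontr)
      assume "\<not> small_ball (\<theta> / K * t) \<le> 0"
      then obtain k :: nat where k: "L < k * small_ball (\<theta> / K * t)"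
        using reals_Archimedean3[of "small_ball (\<theta> / K * t)"] by auto
      also have "\<dots> \<le> (k + N + 1) * small_ball (\<theta> / K * t)" by (intro mult_right_mono) auto
      also have "\<dots> \<le> L" using bound[of "k + N + 1"] by simp
      finally show False by simp
    qed
    then show ?thesis using small_ball_nonneg[of t] by linarith
  qed
  then have "small_ball_decay (1 / 2) (\<theta> / K) c" by (simp add: small_ball_decay_def)
  moreover have "0 < \<theta> / K" "0 < c" using \<theta> K a[OF N(1)] by (auto simp: c_def)
  ultimately show ?thesis by blast
qed

end

theorem theorem3p4:
  fixes M :: "'a measure" and X :: "'a \<Rightarrow> real" and p q :: real
  assumes "prob_space M"
    and "X \<in> borel_measurable M"
    and "AE \<omega> in M. 0 \<le> X \<omega>"
    and "0 < p" and "p < q"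
    and "integrable M (\<lambda>\<omega>. \<bar>X \<omega>\<bar> powr q)"
  shows
    "let cond_i = (\<exists>C::real. \<forall>n\<ge>1.
             Lnorm (copy_space n M) q (min_copies n X)
               \<le> C * Lnorm (copy_space n M) p (min_copies n X));
         cond_ii = (\<exists>\<epsilon><1. \<exists>\<tau>>0. \<exists>\<rho>>0. \<forall>t::real. 0 < t \<and> t \<le> \<rho> * Lnorm M p X \<longrightarrow>
             \<P>(\<omega> in M. X \<omega> \<le> \<tau> * t) \<le> \<epsilon> * \<P>(\<omega> in M. X \<omega> \<le> t));
         cond_iii = (\<forall>\<epsilon>>0. \<forall>\<rho>>0. \<exists>\<tau>>0. \<forall>t::real. 0 < t \<and> t \<le> \<rho> * Lnorm M p X \<longrightarrow>
             \<P>(\<omega> in M. X \<omega> \<le> \<tau> * t) \<le> \<epsilon> * \<P>(\<omega> in M. X \<omega> \<le> t));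
         cond_iv = (\<exists>\<sigma>>0. \<forall>t\<ge>0.
             (\<integral>\<omega>. (min t (\<sigma> * X \<omega>)) powr q \<partial>M) powr (1 / q)
               \<le> (\<integral>\<omega>. (min t (X \<omega>)) powr p \<partial>M) powr (1 / p))
     in (cond_i \<longleftrightarrow> cond_ii) \<and> (cond_ii \<longleftrightarrow> cond_iii) \<and> (cond_iii \<longleftrightarrow> cond_iv)"
proof -
  interpret prob_space M by fact
  interpret nonneg_rv M X using assms(2,3) by unfold_locales
  note p = assms(4) and pq = assms(5) and int = assms(6)
  have q: "0 < q" using p pq by simp
  have intp: "integrable M (\<lambda>\<omega>. \<bar>X \<omega>\<bar> powr p)" using integrable_powr_le[OF p _ int] pq by simp
  let ?a = "Lnorm M p X"
  let ?i = "\<exists>C. \<forall>n\<ge>1. Lnorm (copy_space n M) q (min_copies n X)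
       \<le> C * Lnorm (copy_space n M) p (min_copies n X)"
  let ?ii = "\<exists>\<epsilon><1. \<exists>\<tau>>0. \<exists>\<rho>>0. small_ball_decay \<epsilon> \<tau> (\<rho> * ?a)"
  let ?iii = "\<forall>\<epsilon>>0. \<forall>\<rho>>0. \<exists>\<tau>>0. small_ball_decay \<epsilon> \<tau> (\<rho> * ?a)"
  let ?iv = "\<exists>\<sigma>>0. \<forall>t\<ge>0. (\<integral>\<omega>. (min t (\<sigma> * X \<omega>)) powr q \<partial>M) powr (1 / q)
       \<le> (\<integral>\<omega>. (min t (X \<omega>)) powr p \<partial>M) powr (1 / p)"
  have "(?i \<longleftrightarrow> ?ii) \<and> (?ii \<longleftrightarrow> ?iii) \<and> (?iii \<longleftrightarrow> ?iv)"
  proof (cases "?a = 0")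
    case True
    have tail0: "tail s = 0" if "0 < s" for s
      using Lnorm_pos[OF that _ p intp] True tail_nonneg[of s] by linarith
    have decay0: "small_ball_decay \<epsilon> \<tau> (\<rho> * ?a)" for \<epsilon> \<tau> \<rho>
      using True by (simp add: small_ball_decay_def)
    have ii: ?ii
      by (rule exI[of _ 0], rule conjI[OF _ exI[of _ 1]]) (auto intro: exI[of _ 1] decay0)
    have iii: ?iii
      by (auto intro: exI[of _ 1] decay0)
    have ?iv
    proof (intro exI[of _ 1] conjI allI impI)
      fix t :: real assume t: "0 \<le> t"
      have "moment q = 0" using moment_eq_0[OF q] tail0 by blast
      then have "(\<integral>\<omega>. min t (1 * X \<omega>) powr q \<partial>M) \<le> 0"
        using trunc_moment_le_moment[OF t _ q int, of 1] by simp
      then have "(\<integral>\<omega>. min t (1 * X \<omega>) powr q \<partial>M) = 0"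
        by (intro antisym) auto
      then show "(\<integral>\<omega>. min t (1 * X \<omega>) powr q \<partial>M) powr (1 / q) \<le> (\<integral>\<omega>. min t (X \<omega>) powr p \<partial>M) powr (1 / p)"
        by simp
    qed simp
    moreover have ?i
    proof (intro exI[of _ 0] allI impI)
      fix n :: nat assume n: "1 \<le> n"
      interpret Y: nonneg_rv "copy_space n M" "min_copies n X" by (rule min_copies_rv[OF n])
      have "Y.moment q = 0"
        using Y.moment_eq_0[OF q] n by (simp add: tail0 min_copies_rv(2))
      then show "Lnorm (copy_space n M) q (min_copies n X) \<le> 0 * Lnorm (copy_space n M) p (min_copies n X)"
        by (simp add: Lnorm_def)
    qed
    ultimately show ?thesis using ii iii by blast
  next
    case False
    then have a: "0 < ?a" using Lnorm_nonneg[of p] by linarith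
    define c where "c = ?a / 2"
    have c: "0 < c" "0 < tail c" using a tail_half_Lnorm_pos[OF p intp a] by (auto simp: c_def)
    have ii_decay: "?ii \<longleftrightarrow> (\<exists>\<epsilon><1. \<exists>\<tau>>0. \<exists>c>0. small_ball_decay \<epsilon> \<tau> c)"
      using a by (metis mult_pos_pos divide_pos_pos nonzero_eq_divide_eq False)
    have ii_iii: ?iii if ii: ?ii
    proof (intro allI impI)
      fix \<epsilon>' \<rho>' :: real assume *: "0 < \<epsilon>'" "0 < \<rho>'"
      from ii obtain \<epsilon> \<tau> \<rho> where "\<epsilon> < 1" "0 < \<tau>" "0 < \<rho>" "small_ball_decay \<epsilon> \<tau> (\<rho> * ?a)" by blast
      from small_ball_decay_improve[OF this(4,1,2) _ *(1), of "\<rho>' * ?a"] this * a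
      show "\<exists>\<tau>>0. small_ball_decay \<epsilon>' \<tau> (\<rho>' * ?a)" by auto
    qed
    have iii_ii: ?ii if iii: ?iii
    proof -
      obtain \<tau> where "0 < \<tau>" "small_ball_decay (1 / 2) \<tau> (1 * ?a)"
        using iii[rule_format, of "1 / 2" 1] by auto
      then show ?ii by (intro exI[of _ "1/2"] exI[of _ \<tau>] exI[of _ 1] conjI) auto
    qed
    have iii_c: "\<exists>\<tau>>0. \<tau> \<le> 1 \<and> small_ball_decay \<epsilon> \<tau> c" if iii: ?iii and \<epsilon>: "0 < \<epsilon>" for \<epsilon>
    proof -
      obtain \<tau> where "0 < \<tau>" "small_ball_decay \<epsilon> \<tau> (1 / 2 * ?a)"
        using iii[rule_format, OF \<epsilon>, of "1 / 2"] by auto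
      then show ?thesis
        using small_ball_decay_weaken[of \<epsilon> \<tau> c \<epsilon> "min \<tau> 1"] by (intro exI[of _ "min \<tau> 1"]) (auto simp: c_def)
    qed
    have iii_i: ?i if iii: ?iii
    proof -
      obtain \<tau> where "0 < \<tau>" "\<tau> \<le> 1" "small_ball_decay (1 / 2) \<tau> c"
        using iii_c[OF iii, of "1 / 2"] by auto
      then show ?i by (intro decay_imp_min_copies_comparison[OF p pq int c])
    qed
    have i_ii: ?ii if i: ?i
    proof -
      obtain C where C: "Lnorm (copy_space n M) q (min_copies n X) \<le> C * Lnorm (copy_space n M) p (min_copies n X)"
        if "1 \<le> n" for n using i by blast
      have "Lnorm (copy_space n M) q (min_copies n X) \<le> max C 1 * Lnorm (copy_space n M) p (min_copies n X)"
        if "1 \<le> n" for n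
        by (rule order.trans[OF C[OF that] mult_right_mono]) (auto simp: Lnorm_def)
      then have "\<exists>\<tau>>0. \<exists>c>0. small_ball_decay (1 / 2) \<tau> c"
        by (intro min_copies_comparison_imp_decay[OF p pq int a, of "max C 1"]) auto
      then show ?ii unfolding ii_decay by (intro exI[of _ "1 / 2"]) auto
    qed
    have iii_iv: ?iv if iii: ?iii
      by (rule decay_imp_trunc_comparison[OF p q int c iii_c[OF iii]])
    have iv_ii: ?ii if iv: ?iv
    proof -
      obtain \<sigma> where \<sigma>: "0 < \<sigma>" and comp: "\<And>t. 0 \<le> t \<Longrightarrow> (\<integral>\<omega>. (min t (\<sigma> * X \<omega>)) powr q \<partial>M) powr (1 / q)
          \<le> (\<integral>\<omega>. (min t (X \<omega>)) powr p \<partial>M) powr (1 / p)"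
        using iv by blast
      have "0 < c / \<sigma>" using c \<sigma> by simp
      then show ?ii
        unfolding ii_decay using trunc_comparison_imp_decay[OF p pq \<sigma> c comp] by blast
    qed
    show ?thesis
    proof (intro conjI iffI)
      show ?ii if ?i using that by (rule i_ii)
      show ?i if ?ii using iii_i[OF ii_iii[OF that]] .
      show ?iii if ?ii using that by (rule ii_iii)
      show ?ii if ?iii using that by (rule iii_ii)
      show ?iv if ?iii using that by (rule iii_iv)
      show ?iii if ?iv using ii_iii[OF iv_ii[OF that]] .
    qed
  qed
  then show ?thesis unfolding Let_def small_ball_decay_def small_ball_def .
qed

end
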